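(* Let $n\ge2$ and $m\ge2$ be integers and let $\mathfrak{G}$ be a generalized $n$-matrix ring, with diagonal rings $\mathfrak{R}_1,\dots,\mathfrak{R}_n$, such that for all $1\le i\neq j\le n$: (i) for $a_{ii}\in\mathfrak{R}_i$, if $a_{ii}\mathfrak{R}_i=0$ then $a_{ii}=0$; (ii) for $b_{jj}\in\mathfrak{R}_j$, if $\mathfrak{R}_jb_{jj}=0$ then $b_{jj}=0$. Then every $m$-multiplicative isomorphism $\varphi$ from $\mathfrak{G}$ onto a ring $\mathfrak{R}$ is additive, i.e. $\varphi(x+y)=\varphi(x)+\varphi(y)$ for all $x,y\in\mathfrak{G}$.
   Context: Rings are associative, not necessarily with identity. Given rings $\mathfrak{S},\mathfrak{S}'$, a bijective map $\varphi:\mathfrak{S}\to\mathfrak{S}'$ (not assumed additive) is an $m$-multiplicative isomorphism if $\varphi(x_1\cdots x_m)=\varphi(x_1)\cdots\varphi(x_m)$ for all $x_1,\dots,x_m\in\mathfrak{S}$. Generalized $n$-matrix ring: let $\mathfrak{R}_1,\dots,\mathfrak{R}_n$ be rings and, for $i,j\in\{1,\dots,n\}$, let $\mathfrak{M}_{ij}$ be an $(\mathfrak{R}_i,\mathfrak{R}_j)$-bimodule, with $\mathfrak{M}_{ii}=\mathfrak{R}_i$. Let $\varphi_{ijk}:\mathfrak{M}_{ij}\otimes_{\mathfrak{R}_j}\mathfrak{M}_{jk}\to\mathfrak{M}_{ik}$ be $(\mathfrak{R}_i,\mathfrak{R}_k)$-bimodule homomorphisms, where $\varphi_{iij}:\mathfrak{R}_i\otimes_{\mathfrak{R}_i}\mathfrak{M}_{ij}\to\mathfrak{M}_{ij}$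 and $\varphi_{ijj}:\mathfrak{M}_{ij}\otimes_{\mathfrak{R}_j}\mathfrak{R}_j\to\mathfrak{M}_{ij}$ are the canonical isomorphisms (given by the module actions). Write $a\circ b=\varphi_{ijk}(a\otimes b)$ for $a\in\mathfrak{M}_{ij}$, $b\in\mathfrak{M}_{jk}$. It is assumed that for all $i\neq j$: (1) $\mathfrak{M}_{ij}$ is faithful as a left $\mathfrak{R}_i$-module and faithful as a right $\mathfrak{R}_j$-module; (2) if $m_{ij}\in\mathfrak{M}_{ij}$ satisfies $\mathfrak{R}_i m_{ij}\mathfrak{R}_j=0$, then $m_{ij}=0$. Let $\mathfrak{G}$ be the set of all $n\times n$ matrices $[m_{ij}]$ with $(i,j)$-entry $m_{ij}\in\mathfrak{M}_{ij}$, with the obvious matrix addition and multiplication (using $\circ$). When $a\circ(b\circ c)=(a\circ b)\circ c$ for all $a\in\mathfrak{M}_{ik}$, $b\in\mathfrak{M}_{kl}$, $c\in\mathfrak{M}_{lj}$ and all indices, $\mathfrak{G}$ is a ring, called a generalized $n$-matrix ring. *)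

theory Defs
  imports "HOL-Algebra.Free_Abelian_Groups" "HOL-Algebra.Module"
begin

section \<open>Rings without identity and \<open>m\<close>-multiplicative isomorphisms\<close>

text \<open>
  As the library's \<^locale>\<open>module\<close> does for its carrier of vectors, we reuse the record type
  \<open>ring\<close> and leave the fields that have no meaning (here \<open>one\<close>) unconstrained.
\<close>

locale nonunital_ring = abelian_group R for R (structure) +
  assumes mult_closed: "\<lbrakk>x \<in> carrier R; y \<in> carrier R\<rbrakk> \<Longrightarrow> x \<otimes> y \<in> carrier R"
    and mult_assoc: "\<lbrakk>x \<in> carrier R; y \<in> carrier R; z \<in> carrier R\<rbrakk>
      \<Longrightarrow> (x \<otimes> y) \<otimes> z = x \<otimes> (y \<otimes> z)"
    and distrib_right: "\<lbrakk>x \<in> carrier R; y \<in> carrier R; z \<in> carrier R\<rbrakk>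
      \<Longrightarrow> (x \<oplus> y) \<otimes> z = x \<otimes> z \<oplus> y \<otimes> z"
    and distrib_left: "\<lbrakk>x \<in> carrier R; y \<in> carrier R; z \<in> carrier R\<rbrakk>
      \<Longrightarrow> z \<otimes> (x \<oplus> y) = z \<otimes> x \<oplus> z \<otimes> y"

text \<open>Product \<open>x\<^sub>1 \<cdots> x\<^sub>m\<close> of a nonempty list; no unit is involved.\<close>

definition list_product :: "('a, 'e) ring_scheme \<Rightarrow> 'a list \<Rightarrow> 'a" where
  "list_product R xs = foldl (monoid.mult R) (hd xs) (tl xs)"

definition multiplicative_iso ::
  "nat \<Rightarrow> ('a, 'e) ring_scheme \<Rightarrow> ('b, 'f) ring_scheme \<Rightarrow> ('a \<Rightarrow> 'b) \<Rightarrow> bool" where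
  "multiplicative_iso m R S f \<longleftrightarrow>
     bij_betw f (carrier R) (carrier S) \<and>
     (\<forall>xs. length xs = m \<and> set xs \<subseteq> carrier R \<longrightarrow>
        f (list_product R xs) = list_product S (map f xs))"


section \<open>Bimodules and their tensor products\<close>

text \<open>The fields \<open>mult\<close> and \<open>one\<close> of a bimodule are unused.\<close>

record ('r, 'm, 's) bimodule = "'m ring" +
  lsmult :: "'r \<Rightarrow> 'm \<Rightarrow> 'm" (infixr \<open>\<triangleright>\<index>\<close> 70)
  rsmult :: "'m \<Rightarrow> 's \<Rightarrow> 'm" (infixl \<open>\<triangleleft>\<index>\<close> 70)

locale bimodule = R: nonunital_ring R + S: nonunital_ring S + abelian_group M
  for R :: "('r, 'd) ring_scheme" and S :: "('s, 'e) ring_scheme"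
    and M :: "('r, 'm, 's, 'f) bimodule_scheme" (structure) +
  assumes lsmult_closed: "\<lbrakk>r \<in> carrier R; x \<in> carrier M\<rbrakk> \<Longrightarrow> r \<triangleright> x \<in> carrier M"
    and rsmult_closed: "\<lbrakk>x \<in> carrier M; s \<in> carrier S\<rbrakk> \<Longrightarrow> x \<triangleleft> s \<in> carrier M"
    and lsmult_add_scalar: "\<lbrakk>r \<in> carrier R; r' \<in> carrier R; x \<in> carrier M\<rbrakk>
      \<Longrightarrow> (r \<oplus>\<^bsub>R\<^esub> r') \<triangleright> x = r \<triangleright> x \<oplus> r' \<triangleright> x"
    and lsmult_add: "\<lbrakk>r \<in> carrier R; x \<in> carrier M; y \<in> carrier M\<rbrakk>
      \<Longrightarrow> r \<triangleright> (x \<oplus> y) = r \<triangleright> x \<oplus> r \<triangleright> y"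
    and lsmult_assoc: "\<lbrakk>r \<in> carrier R; r' \<in> carrier R; x \<in> carrier M\<rbrakk>
      \<Longrightarrow> (r \<otimes>\<^bsub>R\<^esub> r') \<triangleright> x = r \<triangleright> (r' \<triangleright> x)"
    and rsmult_add_scalar: "\<lbrakk>x \<in> carrier M; s \<in> carrier S; s' \<in> carrier S\<rbrakk>
      \<Longrightarrow> x \<triangleleft> (s \<oplus>\<^bsub>S\<^esub> s') = x \<triangleleft> s \<oplus> x \<triangleleft> s'"
    and rsmult_add: "\<lbrakk>x \<in> carrier M; y \<in> carrier M; s \<in> carrier S\<rbrakk>
      \<Longrightarrow> (x \<oplus> y) \<triangleleft> s = x \<triangleleft> s \<oplus> y \<triangleleft> s"
    and rsmult_assoc: "\<lbrakk>x \<in> carrier M; s \<in> carrier S; s' \<in> carrier S\<rbrakk>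
      \<Longrightarrow> x \<triangleleft> (s \<otimes>\<^bsub>S\<^esub> s') = (x \<triangleleft> s) \<triangleleft> s'"
    and smult_smult: "\<lbrakk>r \<in> carrier R; x \<in> carrier M; s \<in> carrier S\<rbrakk>
      \<Longrightarrow> (r \<triangleright> x) \<triangleleft> s = r \<triangleright> (x \<triangleleft> s)"

definition regular_bimodule :: "'a ring \<Rightarrow> ('a, 'a, 'a) bimodule" where
  "regular_bimodule R =
     \<lparr>carrier = carrier R, monoid.mult = monoid.mult R, one = one R, ring.zero = ring.zero R, ring.add = ring.add R,
      lsmult = monoid.mult R, rsmult = monoid.mult R\<rparr>"

definition bimodule_hom ::
  "('r, 'd) ring_scheme \<Rightarrow> ('s, 'e) ring_scheme \<Rightarrow> ('r, 'm, 's, 'f) bimodule_scheme \<Rightarrow>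
   ('r, 'n, 's, 'g) bimodule_scheme \<Rightarrow> ('m \<Rightarrow> 'n) set" where
  "bimodule_hom R S M N =
     {h. h \<in> carrier M \<rightarrow> carrier N \<and>
         (\<forall>x\<in>carrier M. \<forall>y\<in>carrier M. h (x \<oplus>\<^bsub>M\<^esub> y) = h x \<oplus>\<^bsub>N\<^esub> h y) \<and>
         (\<forall>r\<in>carrier R. \<forall>x\<in>carrier M. h (r \<triangleright>\<^bsub>M\<^esub> x) = r \<triangleright>\<^bsub>N\<^esub> h x) \<and>
         (\<forall>x\<in>carrier M. \<forall>s\<in>carrier S. h (x \<triangleleft>\<^bsub>M\<^esub> s) = h x \<triangleleft>\<^bsub>N\<^esub> s)}"

text \<open>
  The tensor product \<open>A \<otimes>\<^sub>S B\<close> is the free abelian group on the pairs \<open>(a, b)\<close> modulo the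
  subgroup generated by the relations of biadditivity and \<open>S\<close>-balancedness. Its elements are
  cosets of formal sums.
\<close>

definition tensor_free ::
  "('r, 'a, 's, 'f) bimodule_scheme \<Rightarrow> ('s, 'b, 't, 'g) bimodule_scheme \<Rightarrow>
   ('a \<times> 'b \<Rightarrow>\<^sub>0 int) monoid" where
  "tensor_free A B = free_Abelian_group (carrier A \<times> carrier B)"

definition tensor_relators ::
  "('s, 'e) ring_scheme \<Rightarrow> ('r, 'a, 's, 'f) bimodule_scheme \<Rightarrow>
   ('s, 'b, 't, 'g) bimodule_scheme \<Rightarrow> ('a \<times> 'b \<Rightarrow>\<^sub>0 int) set" where
  "tensor_relators S A B =
     {frag_of (a \<oplus>\<^bsub>A\<^esub> a', b) - frag_of (a, b) - frag_of (a', b) | a a' b.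
        a \<in> carrier A \<and> a' \<in> carrier A \<and> b \<in> carrier B} \<union>
     {frag_of (a, b \<oplus>\<^bsub>B\<^esub> b') - frag_of (a, b) - frag_of (a, b') | a b b'.
        a \<in> carrier A \<and> b \<in> carrier B \<and> b' \<in> carrier B} \<union>
     {frag_of (a \<triangleleft>\<^bsub>A\<^esub> s, b) - frag_of (a, s \<triangleright>\<^bsub>B\<^esub> b) | a s b.
        a \<in> carrier A \<and> s \<in> carrier S \<and> b \<in> carrier B}"

definition tensor_kernel ::
  "('s, 'e) ring_scheme \<Rightarrow> ('r, 'a, 's, 'f) bimodule_scheme \<Rightarrow>
   ('s, 'b, 't, 'g) bimodule_scheme \<Rightarrow> ('a \<times> 'b \<Rightarrow>\<^sub>0 int) set" where
  "tensor_kernel S A B = generate (tensor_free A B) (tensor_relators S A B)"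

definition pure_tensor ::
  "('s, 'e) ring_scheme \<Rightarrow> ('r, 'a, 's, 'f) bimodule_scheme \<Rightarrow>
   ('s, 'b, 't, 'g) bimodule_scheme \<Rightarrow> 'a \<Rightarrow> 'b \<Rightarrow> ('a \<times> 'b \<Rightarrow>\<^sub>0 int) set" where
  "pure_tensor S A B a b = tensor_kernel S A B #>\<^bsub>tensor_free A B\<^esub> frag_of (a, b)"

text \<open>
  The outer actions are induced by the additive extensions of \<open>(a, b) \<mapsto> (r a, b)\<close> and
  \<open>(a, b) \<mapsto> (a, b t)\<close>. Such an extension maps a coset only into a coset; adding the kernel
  \<open>K\<close> yields the full coset.
\<close>

definition tensor_product ::
  "('s, 'e) ring_scheme \<Rightarrow> ('r, 'a, 's, 'f) bimodule_scheme \<Rightarrow>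
   ('s, 'b, 't, 'g) bimodule_scheme \<Rightarrow> ('r, ('a \<times> 'b \<Rightarrow>\<^sub>0 int) set, 't) bimodule" where
  "tensor_product S A B =
     (let F = tensor_free A B; K = tensor_kernel S A B in
      \<lparr>carrier = carrier (F Mod K), monoid.mult = undefined, one = undefined,
       ring.zero = one (F Mod K), ring.add = monoid.mult (F Mod K),
       lsmult = (\<lambda>r U. K <#>\<^bsub>F\<^esub> (frag_extend (\<lambda>(a, b). frag_of (r \<triangleright>\<^bsub>A\<^esub> a, b)) ` U)),
       rsmult = (\<lambda>U t. K <#>\<^bsub>F\<^esub> (frag_extend (\<lambda>(a, b). frag_of (a, b \<triangleleft>\<^bsub>B\<^esub> t)) ` U))\<rparr>)"


section \<open>Generalized matrix rings\<close>

text \<open>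
  Indices range over \<open>{1..n}\<close>. All the \<open>M i j\<close> have elements in one type \<open>'a\<close>, but each has its
  own carrier and its own operations. Without identities the canonical map
  \<open>R i \<otimes> M i j \<rightarrow> M i j\<close> given by the action need not be bijective, so that the canonical
  maps are isomorphisms is an assumption of its own (\<open>left_iso\<close>, \<open>right_iso\<close>).
\<close>

definition circ ::
  "(nat \<Rightarrow> 'a ring) \<Rightarrow> (nat \<Rightarrow> nat \<Rightarrow> ('a, 'a, 'a) bimodule) \<Rightarrow>
   (nat \<Rightarrow> nat \<Rightarrow> nat \<Rightarrow> ('a \<times> 'a \<Rightarrow>\<^sub>0 int) set \<Rightarrow> 'a) \<Rightarrow>
   nat \<Rightarrow> nat \<Rightarrow> nat \<Rightarrow> 'a \<Rightarrow> 'a \<Rightarrow> 'a" where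
  "circ R M \<phi> i j k a b = \<phi> i j k (pure_tensor (R j) (M i j) (M j k) a b)"

locale generalized_matrix_ring =
  fixes n :: nat
    and R :: "nat \<Rightarrow> 'a ring"
    and M :: "nat \<Rightarrow> nat \<Rightarrow> ('a, 'a, 'a) bimodule"
    and \<phi> :: "nat \<Rightarrow> nat \<Rightarrow> nat \<Rightarrow> ('a \<times> 'a \<Rightarrow>\<^sub>0 int) set \<Rightarrow> 'a"
  assumes ring: "i \<in> {1..n} \<Longrightarrow> nonunital_ring (R i)"
    and bimodule: "\<lbrakk>i \<in> {1..n}; j \<in> {1..n}\<rbrakk> \<Longrightarrow> bimodule (R i) (R j) (M i j)"
    and diagonal: "i \<in> {1..n} \<Longrightarrow> M i i = regular_bimodule (R i)"
    and hom: "\<lbrakk>i \<in> {1..n}; j \<in> {1..n}; k \<in> {1..n}\<rbrakk>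
      \<Longrightarrow> \<phi> i j k \<in> bimodule_hom (R i) (R k) (tensor_product (R j) (M i j) (M j k)) (M i k)"
    and left_canonical: "\<lbrakk>i \<in> {1..n}; j \<in> {1..n}; r \<in> carrier (R i); x \<in> carrier (M i j)\<rbrakk>
      \<Longrightarrow> circ R M \<phi> i i j r x = r \<triangleright>\<^bsub>M i j\<^esub> x"
    and right_canonical: "\<lbrakk>i \<in> {1..n}; j \<in> {1..n}; x \<in> carrier (M i j); s \<in> carrier (R j)\<rbrakk>
      \<Longrightarrow> circ R M \<phi> i j j x s = x \<triangleleft>\<^bsub>M i j\<^esub> s"
    and left_iso: "\<lbrakk>i \<in> {1..n}; j \<in> {1..n}\<rbrakk>
      \<Longrightarrow> bij_betw (\<phi> i i j) (carrier (tensor_product (R i) (M i i) (M i j))) (carrier (M i j))"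
    and right_iso: "\<lbrakk>i \<in> {1..n}; j \<in> {1..n}\<rbrakk>
      \<Longrightarrow> bij_betw (\<phi> i j j) (carrier (tensor_product (R j) (M i j) (M j j))) (carrier (M i j))"
    and left_faithful: "\<lbrakk>i \<in> {1..n}; j \<in> {1..n}; i \<noteq> j; r \<in> carrier (R i);
        \<forall>x\<in>carrier (M i j). r \<triangleright>\<^bsub>M i j\<^esub> x = \<zero>\<^bsub>M i j\<^esub>\<rbrakk> \<Longrightarrow> r = \<zero>\<^bsub>R i\<^esub>"
    and right_faithful: "\<lbrakk>i \<in> {1..n}; j \<in> {1..n}; i \<noteq> j; s \<in> carrier (R j);
        \<forall>x\<in>carrier (M i j). x \<triangleleft>\<^bsub>M i j\<^esub> s = \<zero>\<^bsub>M i j\<^esub>\<rbrakk> \<Longrightarrow> s = \<zero>\<^bsub>R j\<^esub>"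
    and two_sided_zero: "\<lbrakk>i \<in> {1..n}; j \<in> {1..n}; i \<noteq> j; x \<in> carrier (M i j);
        \<forall>r\<in>carrier (R i). \<forall>s\<in>carrier (R j). (r \<triangleright>\<^bsub>M i j\<^esub> x) \<triangleleft>\<^bsub>M i j\<^esub> s = \<zero>\<^bsub>M i j\<^esub>\<rbrakk>
      \<Longrightarrow> x = \<zero>\<^bsub>M i j\<^esub>"
    and circ_assoc: "\<lbrakk>i \<in> {1..n}; k \<in> {1..n}; l \<in> {1..n}; j \<in> {1..n};
        a \<in> carrier (M i k); b \<in> carrier (M k l); c \<in> carrier (M l j)\<rbrakk>
      \<Longrightarrow> circ R M \<phi> i k j a (circ R M \<phi> k l j b c) =
          circ R M \<phi> i l j (circ R M \<phi> i k l a b) c"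

text \<open>
  A matrix is a function on index pairs, \<open>undefined\<close> outside the index range, so that matrices
  are equal iff their entries are.
\<close>

definition matrix_ring ::
  "nat \<Rightarrow> (nat \<Rightarrow> 'a ring) \<Rightarrow> (nat \<Rightarrow> nat \<Rightarrow> ('a, 'a, 'a) bimodule) \<Rightarrow>
   (nat \<Rightarrow> nat \<Rightarrow> nat \<Rightarrow> ('a \<times> 'a \<Rightarrow>\<^sub>0 int) set \<Rightarrow> 'a) \<Rightarrow> (nat \<times> nat \<Rightarrow> 'a) ring" where
  "matrix_ring n R M \<phi> =
     \<lparr>carrier = (\<Pi>\<^sub>E (i, j)\<in>{1..n} \<times> {1..n}. carrier (M i j)),
      monoid.mult = (\<lambda>x y. \<lambda>(i, j)\<in>{1..n} \<times> {1..n}.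
        \<Oplus>\<^bsub>M i j\<^esub>k\<in>{1..n}. circ R M \<phi> i k j (x (i, k)) (y (k, j))),
      one = undefined,
      ring.zero = (\<lambda>(i, j)\<in>{1..n} \<times> {1..n}. \<zero>\<^bsub>M i j\<^esub>),
      ring.add = (\<lambda>x y. \<lambda>(i, j)\<in>{1..n} \<times> {1..n}. x (i, j) \<oplus>\<^bsub>M i j\<^esub> y (i, j))\<rparr>"

end

theory Submission
  imports Defs "HOL-Algebra.AbelCoset"
begin

text \<open>
  Call a product of \<open>m - 1\<close> elements of diagonal blocks \<open>R i\<close> a word. Given \<open>x\<close> and \<open>y\<close>, pick \<open>z\<close>
  with \<open>f z = f x + f y\<close>; then \<open>f (P z Q) = f (P x Q) + f (P y Q)\<close> for all words \<open>P\<close>, \<open>Q\<close>, and the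
  annihilator conditions make a matrix determined by its products \<open>P z Q\<close>. Hence \<open>f\<close> is additive on
  \<open>x\<close>, \<open>y\<close> as soon as it is additive on all \<open>P x Q\<close>, \<open>P y Q\<close>. As \<open>P x Q\<close> lies in a single block, \<open>f\<close>
  is additive on elements of different blocks. Expanding \<open>(p + P y) (P' x q + q) q' \<cdots>\<close>
  gives additivity on each off-diagonal block, multiplication by a faithful off-diagonal block
  carries it over to the diagonal ones, and the reduction to words then gives it everywhere.
\<close>

section \<open>Words in rings without identity\<close>

context nonunital_ring
begin

lemma l_null:
  assumes "x \<in> carrier R" shows "\<zero> \<otimes> x = \<zero>"
proof -
  have "\<zero> \<otimes> x \<oplus> \<zero> \<otimes> x = \<zero> \<otimes> x \<oplus> \<zero>"
    using assms by (simp add: mult_closed flip: distrib_right)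
  then show ?thesis using assms by (simp add: mult_closed del: r_zero)
qed

lemma r_null:
  assumes "x \<in> carrier R" shows "x \<otimes> \<zero> = \<zero>"
proof -
  have "x \<otimes> \<zero> \<oplus> x \<otimes> \<zero> = x \<otimes> \<zero> \<oplus> \<zero>"
    using assms by (simp add: mult_closed flip: distrib_left)
  then show ?thesis using assms by (simp add: mult_closed del: r_zero)
qed

lemma l_minus:
  assumes "x \<in> carrier R" "y \<in> carrier R" shows "(\<ominus> x) \<otimes> y = \<ominus> (x \<otimes> y)"
proof -
  have "(\<ominus> x) \<otimes> y \<oplus> x \<otimes> y = \<zero>"
    using assms distrib_right[of "\<ominus> x" x y] by (simp add: l_neg l_null)
  then show ?thesis using assms by (intro minus_equality[symmetric]) (simp_all add: mult_closed)
qed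

lemma foldr_closed: "\<lbrakk>set ps \<subseteq> carrier R; z \<in> carrier R\<rbrakk> \<Longrightarrow> foldr (\<otimes>) ps z \<in> carrier R"
  by (induction ps) (auto intro: mult_closed)

lemma foldl_closed: "\<lbrakk>z \<in> carrier R; set qs \<subseteq> carrier R\<rbrakk> \<Longrightarrow> foldl (\<otimes>) z qs \<in> carrier R"
  by (induction qs arbitrary: z) (auto intro: mult_closed)

lemma foldl_mult:
  "\<lbrakk>a \<in> carrier R; z \<in> carrier R; set qs \<subseteq> carrier R\<rbrakk>
    \<Longrightarrow> foldl (\<otimes>) (a \<otimes> z) qs = a \<otimes> foldl (\<otimes>) z qs"
  by (induction qs arbitrary: z) (auto simp: mult_assoc mult_closed)

text \<open>Left multiplication by a word is right-bracketed, while \<open>list_product\<close>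
  brackets to the left. Associativity reconciles the two, so that a map respecting
  \<open>list_product\<close> can also be pushed through left multiplications.\<close>

lemma foldr_eq_foldl:
  "\<lbrakk>set ps \<subseteq> carrier R; z \<in> carrier R; p \<in> carrier R\<rbrakk>
    \<Longrightarrow> foldr (\<otimes>) (p # ps) z = foldl (\<otimes>) p (ps @ [z])"
  by (induction ps arbitrary: p) (auto simp: foldl_mult mult_assoc foldl_closed)

lemma foldr_eq_list_product:
  "\<lbrakk>ps \<noteq> []; set ps \<subseteq> carrier R; z \<in> carrier R\<rbrakk>
    \<Longrightarrow> foldr (\<otimes>) ps z = list_product R (ps @ [z])"
  by (cases ps) (simp_all add: foldr_eq_foldl list_product_def del: foldr_Cons)

lemma foldr_add:
  "\<lbrakk>set ps \<subseteq> carrier R; x \<in> carrier R; y \<in> carrier R\<rbrakk>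
    \<Longrightarrow> foldr (\<otimes>) ps (x \<oplus> y) = foldr (\<otimes>) ps x \<oplus> foldr (\<otimes>) ps y"
  by (induction ps) (auto simp: distrib_left foldr_closed)

lemma foldl_add:
  "\<lbrakk>x \<in> carrier R; y \<in> carrier R; set qs \<subseteq> carrier R\<rbrakk>
    \<Longrightarrow> foldl (\<otimes>) (x \<oplus> y) qs = foldl (\<otimes>) x qs \<oplus> foldl (\<otimes>) y qs"
  by (induction qs arbitrary: x y) (auto simp: distrib_right mult_closed)

lemma foldl_zero: "set qs \<subseteq> carrier R \<Longrightarrow> foldl (\<otimes>) \<zero> qs = \<zero>"
  by (induction qs) (auto simp: l_null)

lemma foldr_zero: "set ps \<subseteq> carrier R \<Longrightarrow> foldr (\<otimes>) ps \<zero> = \<zero>"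
  by (induction ps) (auto simp: r_null)

end


section \<open>Rings with a Peirce-like decomposition\<close>

text \<open>The sets \<open>B i j\<close> imitate the Peirce components e_i G e_j of a ring with
  orthogonal idempotents e_i. In place of idempotents and of a direct decomposition,
  \<open>block_corner\<close> says that elements of \<open>B i i\<close> and \<open>B j j\<close>
  cut a corner out of any z, and \<open>separating\<close> that z is zero once all these corners
  are.\<close>

locale peirce_ring = nonunital_ring G for G (structure) +
  fixes I :: "'i set" and B :: "'i \<Rightarrow> 'i \<Rightarrow> 'a set"
  assumes block_subgroup: "\<lbrakk>i \<in> I; j \<in> I\<rbrakk> \<Longrightarrow> additive_subgroup (B i j) G"
    and block_mult: "\<lbrakk>i \<in> I; j \<in> I; k \<in> I; a \<in> B i j; b \<in> B j k\<rbrakk> \<Longrightarrow> a \<otimes> b \<in> B i k"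
    and block_mult_zero: "\<lbrakk>i \<in> I; j \<in> I; k \<in> I; l \<in> I; j \<noteq> k; a \<in> B i j; b \<in> B k l\<rbrakk>
      \<Longrightarrow> a \<otimes> b = \<zero>"
    and block_corner: "\<lbrakk>i \<in> I; j \<in> I; a \<in> B i i; z \<in> carrier G; b \<in> B j j\<rbrakk>
      \<Longrightarrow> a \<otimes> z \<otimes> b \<in> B i j"
    and separating: "\<lbrakk>z \<in> carrier G;
        \<And>i j a b. \<lbrakk>i \<in> I; j \<in> I; a \<in> B i i; b \<in> B j j\<rbrakk> \<Longrightarrow> a \<otimes> z \<otimes> b = \<zero>\<rbrakk> \<Longrightarrow> z = \<zero>"
    and faithful: "\<lbrakk>i \<in> I; j \<in> I; i \<noteq> j; u \<in> B i i; \<And>b. b \<in> B i j \<Longrightarrow> u \<otimes> b = \<zero>\<rbrakk> \<Longrightarrow> u = \<zero>"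
    and other_index: "i \<in> I \<Longrightarrow> \<exists>j\<in>I. j \<noteq> i"
begin

text \<open>A union and not a sum: each letter of a word belongs to a diagonal block, so its product
  with an element of a block stays in that block, and is zero if the indices do not match.\<close>

definition diag :: "'a set" where
  "diag = (\<Union>i\<in>I. B i i)"

lemma block_closed: "\<lbrakk>i \<in> I; j \<in> I; x \<in> B i j\<rbrakk> \<Longrightarrow> x \<in> carrier G"
  using additive_subgroup.a_Hcarr[OF block_subgroup] by blast

lemma block_zero: "\<lbrakk>i \<in> I; j \<in> I\<rbrakk> \<Longrightarrow> \<zero> \<in> B i j"
  using additive_subgroup.zero_closed[OF block_subgroup] .

lemma block_add: "\<lbrakk>i \<in> I; j \<in> I; x \<in> B i j; y \<in> B i j\<rbrakk> \<Longrightarrow> x \<oplus> y \<in> B i j"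
  using additive_subgroup.a_closed[OF block_subgroup] .

lemma block_minus: "\<lbrakk>i \<in> I; j \<in> I; x \<in> B i j\<rbrakk> \<Longrightarrow> \<ominus> x \<in> B i j"
  using additive_subgroup.a_inv_closed[OF block_subgroup] .

lemma diag_subset: "diag \<subseteq> carrier G"
  using block_closed by (auto simp: diag_def)

lemma words_closed: "set ps \<subseteq> diag \<Longrightarrow> set ps \<subseteq> carrier G"
  using diag_subset by blast

section \<open>Separation of elements by words of a fixed length\<close>

lemma separating_left:
  assumes "z \<in> carrier G" "\<And>a. a \<in> diag \<Longrightarrow> a \<otimes> z = \<zero>"
  shows "z = \<zero>"
proof (rule separating[OF assms(1)])
  fix i j a b assume "i \<in> I" "j \<in> I" "a \<in> B i i" "b \<in> B j j"
  moreover from this have "a \<otimes> z = \<zero>"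
    by (intro assms(2)) (auto simp: diag_def)
  ultimately show "a \<otimes> z \<otimes> b = \<zero>"
    using block_closed l_null by simp
qed

lemma separating_right:
  assumes "z \<in> carrier G" "\<And>a. a \<in> diag \<Longrightarrow> z \<otimes> a = \<zero>"
  shows "z = \<zero>"
proof (rule separating[OF assms(1)])
  fix i j a b assume "i \<in> I" "j \<in> I" "a \<in> B i i" "b \<in> B j j"
  moreover from this have "z \<otimes> b = \<zero>"
    by (intro assms(2)) (auto simp: diag_def)
  ultimately show "a \<otimes> z \<otimes> b = \<zero>"
    using assms(1) block_closed[of i i a] block_closed[of j j b] by (simp add: mult_assoc r_null)
qed

text \<open>Induction on the length, peeling off the letter \<open>a\<close> next to z: the shorter
  words annihilate z a, so z a = 0 by induction, and \<open>separating_right\<close> applies because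
  \<open>a\<close> was arbitrary. The mirror image \<open>foldr_separating\<close> peels off the
  last letter of the left word, again the one next to z.\<close>

lemma foldl_separating:
  assumes "z \<in> carrier G"
    and "\<And>qs. \<lbrakk>length qs = k; set qs \<subseteq> diag\<rbrakk> \<Longrightarrow> foldl (\<otimes>) z qs = \<zero>"
  shows "z = \<zero>"
  using assms
proof (induction k arbitrary: z)
  case 0
  from "0.prems"(2)[of "[]"] show ?case by simp
next
  case (Suc k)
  have "z \<otimes> a = \<zero>" if a: "a \<in> diag" for a
  proof (rule Suc.IH)
    show "z \<otimes> a \<in> carrier G"
      using Suc.prems(1) a diag_subset mult_closed by blast
    show "foldl (\<otimes>) (z \<otimes> a) qs = \<zero>" if "length qs = k" "set qs \<subseteq> diag" for qs
      using Suc.prems(2)[of "a # qs"] that a by simp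
  qed
  with Suc.prems(1) show ?case by (rule separating_right)
qed

lemma foldr_separating:
  assumes "z \<in> carrier G"
    and "\<And>ps. \<lbrakk>length ps = k; set ps \<subseteq> diag\<rbrakk> \<Longrightarrow> foldr (\<otimes>) ps z = \<zero>"
  shows "z = \<zero>"
  using assms
proof (induction k arbitrary: z)
  case 0
  from "0.prems"(2)[of "[]"] show ?case by simp
next
  case (Suc k)
  have "a \<otimes> z = \<zero>" if a: "a \<in> diag" for a
  proof (rule Suc.IH)
    show "a \<otimes> z \<in> carrier G"
      using Suc.prems(1) a diag_subset mult_closed by blast
    show "foldr (\<otimes>) ps (a \<otimes> z) = \<zero>" if "length ps = k" "set ps \<subseteq> diag" for ps
      using Suc.prems(2)[of "ps @ [a]"] that a by simp
  qed
  with Suc.prems(1) show ?case by (rule separating_left)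
qed

lemma minus_eq_zero_imp_eq:
  assumes "x \<in> carrier G" "y \<in> carrier G" "x \<oplus> \<ominus> y = \<zero>"
  shows "x = y"
  using minus_equality[of x "\<ominus> y"] assms by simp

lemma foldl_eqI:
  assumes xy: "x \<in> carrier G" "y \<in> carrier G"
    and eq: "\<And>qs. \<lbrakk>length qs = k; set qs \<subseteq> diag\<rbrakk> \<Longrightarrow> foldl (\<otimes>) x qs = foldl (\<otimes>) y qs"
  shows "x = y"
proof (rule minus_eq_zero_imp_eq[OF xy])
  show "x \<oplus> \<ominus> y = \<zero>"
  proof (rule foldl_separating)
    fix qs assume qs: "length qs = k" "set qs \<subseteq> diag"
    then have c: "set qs \<subseteq> carrier G" using words_closed by blast
    \<comment> \<open>Additivity of the fold splits the left side, \<open>eq\<close> exchanges x for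
      y, and additivity joins the parts again.\<close>
    have "foldl (\<otimes>) (x \<oplus> \<ominus> y) qs = foldl (\<otimes>) (y \<oplus> \<ominus> y) qs"
      using xy eq[OF qs] c by (simp add: foldl_add)
    then show "foldl (\<otimes>) (x \<oplus> \<ominus> y) qs = \<zero>"
      using xy c by (simp add: r_neg foldl_zero)
  qed (use xy in auto)
qed

lemma foldr_eqI:
  assumes xy: "x \<in> carrier G" "y \<in> carrier G"
    and eq: "\<And>ps. \<lbrakk>length ps = k; set ps \<subseteq> diag\<rbrakk> \<Longrightarrow> foldr (\<otimes>) ps x = foldr (\<otimes>) ps y"
  shows "x = y"
proof (rule minus_eq_zero_imp_eq[OF xy])
  show "x \<oplus> \<ominus> y = \<zero>"
  proof (rule foldr_separating)
    fix ps assume ps: "length ps = k" "set ps \<subseteq> diag"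
    then have c: "set ps \<subseteq> carrier G" using words_closed by blast
    have "foldr (\<otimes>) ps (x \<oplus> \<ominus> y) = foldr (\<otimes>) ps (y \<oplus> \<ominus> y)"
      using xy eq[OF ps] c by (simp add: foldr_add)
    then show "foldr (\<otimes>) ps (x \<oplus> \<ominus> y) = \<zero>"
      using xy c by (simp add: r_neg foldr_zero)
  qed (use xy in auto)
qed

section \<open>Action of words on blocks\<close>

lemma diag_mult_block:
  assumes "i \<in> I" "j \<in> I" "x \<in> B i j" "a \<in> diag"
  shows "a \<otimes> x \<in> B i j"
proof -
  obtain k where k: "k \<in> I" "a \<in> B k k"
    using assms(4) by (auto simp: diag_def)
  show ?thesis
  proof (cases "k = i")
    case True
    with assms k show ?thesis by (auto intro: block_mult[of i i j])
  next
    case False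
    with assms k have "a \<otimes> x = \<zero>" by (intro block_mult_zero[of k k i j]) auto
    with assms show ?thesis by (simp add: block_zero)
  qed
qed

lemma block_mult_diag:
  assumes "i \<in> I" "j \<in> I" "x \<in> B i j" "a \<in> diag"
  shows "x \<otimes> a \<in> B i j"
proof -
  obtain k where k: "k \<in> I" "a \<in> B k k"
    using assms(4) by (auto simp: diag_def)
  show ?thesis
  proof (cases "k = j")
    case True
    with assms k show ?thesis by (auto intro: block_mult[of i j j])
  next
    case False
    with assms k have "x \<otimes> a = \<zero>" by (intro block_mult_zero[of i j k k]) auto
    with assms show ?thesis by (simp add: block_zero)
  qed
qed

lemma foldr_block:
  "\<lbrakk>i \<in> I; j \<in> I; x \<in> B i j; set ps \<subseteq> diag\<rbrakk> \<Longrightarrow> foldr (\<otimes>) ps x \<in> B i j"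
  by (induction ps) (auto intro: diag_mult_block)

lemma foldl_block:
  "\<lbrakk>i \<in> I; j \<in> I; x \<in> B i j; set qs \<subseteq> diag\<rbrakk> \<Longrightarrow> foldl (\<otimes>) x qs \<in> B i j"
  by (induction qs arbitrary: x) (auto intro: block_mult_diag)

text \<open>The letters of \<open>ps\<close> keep x in row i, where the outermost letter
  \<open>p\<close> from another index annihilates it. In the right-hand version
  \<open>foldl_block_zero\<close> it is the letter next to x that annihilates, and zero then passes
  through the remaining letters.\<close>

lemma foldr_block_zero:
  assumes "i \<in> I" "j \<in> I" "k \<in> I" "k \<noteq> i" "x \<in> B i j" "p \<in> B k k" "set ps \<subseteq> diag"
  shows "foldr (\<otimes>) (p # ps) x = \<zero>"
proof -
  have "foldr (\<otimes>) ps x \<in> B i j" using assms by (intro foldr_block)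
  with assms show ?thesis by (simp add: block_mult_zero[of k k i j])
qed

lemma foldl_block_zero:
  assumes "i \<in> I" "j \<in> I" "k \<in> I" "k \<noteq> j" "x \<in> B i j" "q \<in> B k k" "set qs \<subseteq> diag"
  shows "foldl (\<otimes>) x (q # qs) = \<zero>"
proof -
  have "x \<otimes> q = \<zero>" using assms by (intro block_mult_zero[of i j k k]) auto
  with assms words_closed show ?thesis by (simp add: foldl_zero)
qed

text \<open>For z in no particular block, the outermost letters on the two sides determine the block
  of the product: by associativity it has the form p w q with w in the ring, to which
  \<open>block_corner\<close> applies.\<close>

lemma word_block:
  assumes z: "z \<in> carrier G" and ps: "set ps \<subseteq> diag" and qs: "set qs \<subseteq> diag"
    and i: "i \<in> I" "p \<in> B i i" and j: "j \<in> I" "q \<in> B j j"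
  shows "foldl (\<otimes>) (foldr (\<otimes>) (p # ps) z) (qs @ [q]) \<in> B i j"
proof -
  have "foldl (\<otimes>) (foldr (\<otimes>) (p # ps) z) (qs @ [q])
      = p \<otimes> foldl (\<otimes>) (foldr (\<otimes>) ps z) qs \<otimes> q"
    using z words_closed[OF ps] words_closed[OF qs] block_closed[OF i(1,1,2)]
    by (simp add: foldl_mult foldr_closed)
  moreover have "foldl (\<otimes>) (foldr (\<otimes>) ps z) qs \<in> carrier G"
    using z words_closed[OF ps] words_closed[OF qs] by (simp add: foldl_closed foldr_closed)
  ultimately show ?thesis
    using i j by (simp add: block_corner)
qed

end


section \<open>Multiplicative isomorphisms of such rings\<close>

locale peirce_multiplicative_iso = peirce_ring G I B + S: nonunital_ring S
  for G (structure) and I :: "'i set" and B and S :: "('b, 'c) ring_scheme" +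
  fixes m :: nat and f :: "'a \<Rightarrow> 'b"
  assumes m_ge_2: "m \<ge> 2"
    and iso: "multiplicative_iso m G S f"
begin

lemma f_bij: "bij_betw f (carrier G) (carrier S)"
  using iso by (simp only: multiplicative_iso_def)

lemma f_list_product:
  "\<lbrakk>length xs = m; set xs \<subseteq> carrier G\<rbrakk> \<Longrightarrow> f (list_product G xs) = list_product S (map f xs)"
  using iso by (simp only: multiplicative_iso_def)

lemma f_closed: "x \<in> carrier G \<Longrightarrow> f x \<in> carrier S"
  using f_bij by (rule bij_betwE[rule_format])

lemma f_map_closed: "set xs \<subseteq> carrier G \<Longrightarrow> set (map f xs) \<subseteq> carrier S"
  using f_closed by auto

lemma f_inj: "\<lbrakk>x \<in> carrier G; y \<in> carrier G; f x = f y\<rbrakk> \<Longrightarrow> x = y"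
  using f_bij by (meson bij_betw_imp_inj_on inj_onD)

lemma f_surj:
  assumes "s \<in> carrier S"
  obtains x where "x \<in> carrier G" "f x = s"
  using assms bij_betw_imp_surj_on[OF f_bij] by (metis imageE)

section \<open>Images of products and of sums under multiplication by words\<close>

lemma f_foldl:
  assumes "z \<in> carrier G" "set qs \<subseteq> carrier G" "length qs = m - 1"
  shows "f (foldl (\<otimes>) z qs) = foldl (\<otimes>\<^bsub>S\<^esub>) (f z) (map f qs)"
  using f_list_product[of "z # qs"] assms m_ge_2 by (simp add: list_product_def)

lemma f_foldr:
  assumes "z \<in> carrier G" "set ps \<subseteq> carrier G" "length ps = m - 1"
  shows "f (foldr (\<otimes>) ps z) = foldr (\<otimes>\<^bsub>S\<^esub>) (map f ps) (f z)"
proof -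
  have ne: "ps \<noteq> []" using assms(3) m_ge_2 by auto
  have "f (list_product G (ps @ [z])) = list_product S (map f ps @ [f z])"
    using f_list_product[of "ps @ [z]"] assms m_ge_2 by simp
  then show ?thesis
    using ne f_closed[OF assms(1)] f_map_closed[OF assms(2)] assms(1,2)
    by (simp add: foldr_eq_list_product S.foldr_eq_list_product)
qed

text \<open>Let x be the preimage of zero. As m - 1 is positive, the m-fold product x 0 ... 0 is
  zero, while its image has first factor \<open>f x\<close> and is therefore zero in
  \<open>S\<close>.\<close>

lemma f_zero: "f \<zero> = \<zero>\<^bsub>S\<^esub>"
proof -
  obtain x where x: "x \<in> carrier G" "f x = \<zero>\<^bsub>S\<^esub>"
    using f_surj[OF S.zero_closed] .
  let ?qs = "replicate (m - 1) \<zero>"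
  have "foldl (\<otimes>) x ?qs = \<zero>"
    using m_ge_2 x by (cases "m - 1") (auto simp: r_null foldl_zero set_replicate_conv_if)
  moreover have "f (foldl (\<otimes>) x ?qs) = \<zero>\<^bsub>S\<^esub>"
    using x f_closed by (subst f_foldl) (auto simp: S.foldl_zero set_replicate_conv_if)
  ultimately show ?thesis by simp
qed

text \<open>The relation \<open>f z\<close> = \<open>f x\<close> + \<open>f y\<close> survives
  multiplication by m - 1 factors, because distributivity holds in \<open>S\<close>. Here z need not
  be known to equal x + y, and the factors may be arbitrary ring elements;
  \<open>f_sum_diagonal\<close> uses one from an off-diagonal block.\<close>

lemma f_sum_foldl:
  assumes "x \<in> carrier G" "y \<in> carrier G" "z \<in> carrier G" "f z = f x \<oplus>\<^bsub>S\<^esub> f y"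
    and "set qs \<subseteq> carrier G" "length qs = m - 1"
  shows "f (foldl (\<otimes>) z qs) = f (foldl (\<otimes>) x qs) \<oplus>\<^bsub>S\<^esub> f (foldl (\<otimes>) y qs)"
  using assms f_map_closed[OF assms(5)] by (simp add: f_foldl S.foldl_add f_closed)

lemma f_sum_foldr:
  assumes "x \<in> carrier G" "y \<in> carrier G" "z \<in> carrier G" "f z = f x \<oplus>\<^bsub>S\<^esub> f y"
    and "set ps \<subseteq> carrier G" "length ps = m - 1"
  shows "f (foldr (\<otimes>) ps z) = f (foldr (\<otimes>) ps x) \<oplus>\<^bsub>S\<^esub> f (foldr (\<otimes>) ps y)"
  using assms f_map_closed[OF assms(5)] by (simp add: f_foldr S.foldr_add f_closed)

text \<open>The product P z Q has 2m - 1 factors; it is read as an m-fold product whose first factor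
  is itself the m-fold product P z, so the relation is transported twice.\<close>

lemma f_sum_word:
  assumes "x \<in> carrier G" "y \<in> carrier G" "z \<in> carrier G" "f z = f x \<oplus>\<^bsub>S\<^esub> f y"
    and "set ps \<subseteq> diag" "length ps = m - 1" "set qs \<subseteq> diag" "length qs = m - 1"
  shows "f (foldl (\<otimes>) (foldr (\<otimes>) ps z) qs)
    = f (foldl (\<otimes>) (foldr (\<otimes>) ps x) qs) \<oplus>\<^bsub>S\<^esub> f (foldl (\<otimes>) (foldr (\<otimes>) ps y) qs)"
proof (rule f_sum_foldl)
  show "f (foldr (\<otimes>) ps z) = f (foldr (\<otimes>) ps x) \<oplus>\<^bsub>S\<^esub> f (foldr (\<otimes>) ps y)"
    using assms words_closed[OF assms(5)] by (intro f_sum_foldr)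
qed (use assms words_closed in \<open>simp_all add: foldr_closed\<close>)

text \<open>Surjectivity provides z with \<open>f z\<close> = \<open>f x\<close> +
  \<open>f y\<close>. On every pair of words the hypothesis and injectivity give P z Q = P x Q + P y
  Q; the separation rules then cancel first Q and then P, whence z = x + y.\<close>

lemma f_add_if_words:
  assumes xy: "x \<in> carrier G" "y \<in> carrier G"
    and words: "\<And>ps qs. \<lbrakk>set ps \<subseteq> diag; length ps = m - 1; set qs \<subseteq> diag; length qs = m - 1\<rbrakk>
      \<Longrightarrow> f (foldl (\<otimes>) (foldr (\<otimes>) ps x) qs \<oplus> foldl (\<otimes>) (foldr (\<otimes>) ps y) qs)
        = f (foldl (\<otimes>) (foldr (\<otimes>) ps x) qs) \<oplus>\<^bsub>S\<^esub> f (foldl (\<otimes>) (foldr (\<otimes>) ps y) qs)"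
  shows "f (x \<oplus> y) = f x \<oplus>\<^bsub>S\<^esub> f y"
proof -
  obtain z where z: "z \<in> carrier G" "f z = f x \<oplus>\<^bsub>S\<^esub> f y"
    using f_surj[OF S.a_closed[OF f_closed[OF xy(1)] f_closed[OF xy(2)]]] .
  have "z = x \<oplus> y"
  proof (rule foldr_eqI[where k = "m - 1"])
    fix ps assume ps: "length ps = m - 1" "set ps \<subseteq> diag"
    show "foldr (\<otimes>) ps z = foldr (\<otimes>) ps (x \<oplus> y)"
    proof (rule foldl_eqI[where k = "m - 1"])
      fix qs assume qs: "length qs = m - 1" "set qs \<subseteq> diag"
      note c = xy z(1) words_closed[OF ps(2)] words_closed[OF qs(2)]
      have "foldl (\<otimes>) (foldr (\<otimes>) ps z) qs
          = foldl (\<otimes>) (foldr (\<otimes>) ps x) qs \<oplus> foldl (\<otimes>) (foldr (\<otimes>) ps y) qs"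
        using f_sum_word[OF xy z ps(2,1) qs(2,1)] words[OF ps(2,1) qs(2,1)] c
        by (intro f_inj) (simp_all add: foldl_closed foldr_closed)
      then show "foldl (\<otimes>) (foldr (\<otimes>) ps z) qs = foldl (\<otimes>) (foldr (\<otimes>) ps (x \<oplus> y)) qs"
        using c by (simp add: foldr_add foldl_add foldr_closed)
    qed (use xy z ps words_closed foldr_closed in auto)
  qed (use xy z in auto)
  with z(2) show ?thesis by simp
qed

lemma word_Cons:
  assumes "set ps \<subseteq> diag" "length ps = m - 1"
  obtains i p ps' where "ps = p # ps'" "i \<in> I" "p \<in> B i i" "set ps' \<subseteq> diag" "length ps' = m - 2"
proof (cases ps)
  case Nil
  with assms m_ge_2 show ?thesis by simp
next
  case (Cons p ps')
  with assms(1) obtain i where "i \<in> I" "p \<in> B i i" by (auto simp: diag_def)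
  with Cons assms that[of p ps' i] show ?thesis by simp
qed

section \<open>Additivity on sums of block elements\<close>

lemma f_add_zero:
  "x \<in> carrier G \<Longrightarrow> f (x \<oplus> \<zero>) = f x \<oplus>\<^bsub>S\<^esub> f \<zero>"
  "x \<in> carrier G \<Longrightarrow> f (\<zero> \<oplus> x) = f \<zero> \<oplus>\<^bsub>S\<^esub> f x"
  by (simp_all add: f_zero f_closed)

lemma f_add_blocks:
  assumes ij: "i \<in> I" "j \<in> I" "x \<in> B i j" and kl: "k \<in> I" "l \<in> I" "y \<in> B k l"
    and ne: "i \<noteq> k \<or> j \<noteq> l"
  shows "f (x \<oplus> y) = f x \<oplus>\<^bsub>S\<^esub> f y"
proof (rule f_add_if_words)
  fix ps qs
  assume ps: "set ps \<subseteq> diag" "length ps = m - 1" and qs: "set qs \<subseteq> diag" "length qs = m - 1"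
  let ?x = "foldl (\<otimes>) (foldr (\<otimes>) ps x) qs" and ?y = "foldl (\<otimes>) (foldr (\<otimes>) ps y) qs"
  obtain i' p ps' where p: "ps = p # ps'" "i' \<in> I" "p \<in> B i' i'" "set ps' \<subseteq> diag"
    using ps by (rule word_Cons)
  obtain j' q qs' where q: "qs = q # qs'" "j' \<in> I" "q \<in> B j' j'" "set qs' \<subseteq> diag"
    using qs by (rule word_Cons)
  have x: "?x = \<zero>" if "i' \<noteq> i \<or> j' \<noteq> j"
  proof (cases "i' = i")
    case False
    then have "foldr (\<otimes>) ps x = \<zero>"
      unfolding p(1) using ij p by (intro foldr_block_zero) auto
    then show ?thesis using qs words_closed by (simp add: foldl_zero)
  next
    case True
    with that ij q foldr_block[OF ij ps(1)] show ?thesis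
      unfolding q(1) by (intro foldl_block_zero) auto
  qed
  have y: "?y = \<zero>" if "i' \<noteq> k \<or> j' \<noteq> l"
  proof (cases "i' = k")
    case False
    then have "foldr (\<otimes>) ps y = \<zero>"
      unfolding p(1) using kl p by (intro foldr_block_zero) auto
    then show ?thesis using qs words_closed by (simp add: foldl_zero)
  next
    case True
    with that kl q foldr_block[OF kl ps(1)] show ?thesis
      unfolding q(1) by (intro foldl_block_zero) auto
  qed
  have "?x \<in> carrier G" "?y \<in> carrier G"
    using assms ps qs words_closed block_closed by (auto intro!: foldl_closed foldr_closed)
  \<comment> \<open>By \<open>ne\<close> the index pair of the letters \<open>p\<close> and
    \<open>q\<close> cannot match both (i, j) and (k, l), so at least one summand is zero.\<close>
  then show "f (?x \<oplus> ?y) = f ?x \<oplus>\<^bsub>S\<^esub> f ?y"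
    using x y ne by (metis f_add_zero)
qed (use assms block_closed in auto)

text \<open>In the product \<open>(p + P y) (P' x q + q) q' \<cdots>\<close> the two cross terms vanish because \<open>i \<noteq> j\<close>,
  and both factors are sums over different blocks, which \<open>f\<close> already respects.\<close>

lemma f_add_off_diagonal_word:
  assumes ij: "i \<in> I" "j \<in> I" "i \<noteq> j" and x: "x \<in> B i j" and y: "y \<in> B i j"
    and p: "p \<in> B i i" and ps: "set ps \<subseteq> diag"
    and q: "q \<in> B j j" and qs: "set qs \<subseteq> diag" "length qs = m - 2"
  shows "f (foldl (\<otimes>) (foldr (\<otimes>) (p # ps) x) (q # qs) \<oplus> foldl (\<otimes>) (foldr (\<otimes>) (p # ps) y) (q # qs))
    = f (foldl (\<otimes>) (foldr (\<otimes>) (p # ps) x) (q # qs))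
      \<oplus>\<^bsub>S\<^esub> f (foldl (\<otimes>) (foldr (\<otimes>) (p # ps) y) (q # qs))"
proof -
  \<comment> \<open>The two words are cut so that each summand becomes a product of two factors
    followed by \<open>qs\<close>: P x Q is p v times \<open>qs\<close>, and P y Q is u q times
    \<open>qs\<close>.\<close>
  define u where "u = foldr (\<otimes>) (p # ps) y"
  define v where "v = foldr (\<otimes>) ps x \<otimes> q"
  have pd: "p \<in> diag" and qd: "q \<in> diag" using p q ij by (auto simp: diag_def)
  have u: "u \<in> B i j"
    unfolding u_def using ij y pd ps by (intro foldr_block) auto
  have v: "v \<in> B i j"
    unfolding v_def using ij x qd ps by (intro block_mult_diag foldr_block) auto
  have c: "p \<in> carrier G" "u \<in> carrier G" "v \<in> carrier G" "q \<in> carrier G" "set qs \<subseteq> carrier G"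
    using ij p q u v qs words_closed block_closed by auto
  have pq: "p \<otimes> q = \<zero>" using block_mult_zero[of i i j j] ij p q by simp
  have uv: "u \<otimes> v = \<zero>" using block_mult_zero[of i j i j] ij u v by simp
  have xc: "foldr (\<otimes>) ps x \<in> carrier G"
    using x ij ps words_closed block_closed by (intro foldr_closed) auto
  \<comment> \<open>With \<open>qs\<close> of length m - 2, \<open>?g a b\<close> has exactly m
    factors, so \<open>f\<close> carries it to \<open>?h (f a) (f b)\<close>.\<close>
  let ?g = "\<lambda>a b. foldl (\<otimes>) a (b # qs)"
  let ?h = "\<lambda>a b. foldl (\<otimes>\<^bsub>S\<^esub>) a (b # map f qs)"
  have fg: "f (?g a b) = ?h (f a) (f b)" if "a \<in> carrier G" "b \<in> carrier G" for a b
    using that c qs m_ge_2 by (subst f_foldl) auto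
  have hl: "?h (a \<oplus>\<^bsub>S\<^esub> a') b = ?h a b \<oplus>\<^bsub>S\<^esub> ?h a' b"
    if "a \<in> carrier S" "a' \<in> carrier S" "b \<in> carrier S" for a a' b
    using that c(5) f_map_closed by (intro S.foldl_add) auto
  have hr: "?h a (b \<oplus>\<^bsub>S\<^esub> b') = ?h a b \<oplus>\<^bsub>S\<^esub> ?h a b'"
    if "a \<in> carrier S" "b \<in> carrier S" "b' \<in> carrier S" for a b b'
    using that f_map_closed[OF c(5)] by (simp add: S.distrib_left S.foldl_add S.mult_closed)
  have px: "foldl (\<otimes>) (foldr (\<otimes>) (p # ps) x) (q # qs) = ?g p v"
    unfolding v_def using c xc by (simp add: mult_assoc)
  have uy: "foldl (\<otimes>) (foldr (\<otimes>) (p # ps) y) (q # qs) = ?g u q"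
    unfolding u_def by simp
  have "(p \<oplus> u) \<otimes> (v \<oplus> q) = p \<otimes> v \<oplus> u \<otimes> q"
    using c pq uv by (simp add: distrib_left distrib_right mult_closed)
  then have "f (?g p v \<oplus> ?g u q) = f (?g (p \<oplus> u) (v \<oplus> q))"
    using c by (simp add: foldl_add mult_closed)
  also have "\<dots> = ?h (f (p \<oplus> u)) (f (v \<oplus> q))"
    using c by (intro fg) auto
  \<comment> \<open>The summands p and u lie in one row but in the different columns i and j; v and
    q share the column but lie in the different rows i and j. Hence \<open>f_add_blocks\<close>
    applies to both factors.\<close>
  also have "\<dots> = ?h (f p \<oplus>\<^bsub>S\<^esub> f u) (f v \<oplus>\<^bsub>S\<^esub> f q)"
    using f_add_blocks[of i i p i j u] f_add_blocks[of i j v j j q] ij p u v q by simp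
  also have "\<dots> = (f (?g p v) \<oplus>\<^bsub>S\<^esub> f (?g u v)) \<oplus>\<^bsub>S\<^esub> (f (?g p q) \<oplus>\<^bsub>S\<^esub> f (?g u q))"
    using c f_closed by (simp only: fg hl hr S.a_closed)
  also have "\<dots> = f (?g p v) \<oplus>\<^bsub>S\<^esub> f (?g u q)"
  proof -
    have "?g p v \<in> carrier G" "?g u q \<in> carrier G"
      using c by (auto intro!: foldl_closed mult_closed)
    moreover have "f (?g p q) = \<zero>\<^bsub>S\<^esub>" "f (?g u v) = \<zero>\<^bsub>S\<^esub>"
      using pq uv c f_zero by (simp_all add: foldl_zero)
    ultimately show ?thesis using f_closed by simp
  qed
  finally show ?thesis unfolding px uy .
qed

text \<open>After the reduction to words, only those whose first letters \<open>p\<close> and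
  \<open>q\<close> come from the diagonal blocks of i and j matter, and these are covered by
  \<open>f_add_off_diagonal_word\<close>. For all other words both products vanish.\<close>

lemma f_add_off_diagonal:
  assumes ij: "i \<in> I" "j \<in> I" "i \<noteq> j" and x: "x \<in> B i j" and y: "y \<in> B i j"
  shows "f (x \<oplus> y) = f x \<oplus>\<^bsub>S\<^esub> f y"
proof (rule f_add_if_words)
  fix ps qs
  assume ps: "set ps \<subseteq> diag" "length ps = m - 1" and qs: "set qs \<subseteq> diag" "length qs = m - 1"
  obtain k p ps' where p: "ps = p # ps'" "k \<in> I" "p \<in> B k k" "set ps' \<subseteq> diag"
    using ps by (rule word_Cons)
  obtain l q qs' where q: "qs = q # qs'" "l \<in> I" "q \<in> B l l" "set qs' \<subseteq> diag" "length qs' = m - 2"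
    using qs by (rule word_Cons)
  show "f (foldl (\<otimes>) (foldr (\<otimes>) ps x) qs \<oplus> foldl (\<otimes>) (foldr (\<otimes>) ps y) qs)
      = f (foldl (\<otimes>) (foldr (\<otimes>) ps x) qs) \<oplus>\<^bsub>S\<^esub> f (foldl (\<otimes>) (foldr (\<otimes>) ps y) qs)"
  proof (cases "k = i \<and> l = j")
    case True
    with p q ij x y show ?thesis
      unfolding p(1) q(1) by (intro f_add_off_diagonal_word[of i j]) auto
  next
    case False
    have "foldl (\<otimes>) (foldr (\<otimes>) ps w) qs = \<zero>" if w: "w \<in> B i j" for w
    proof (cases "k = i")
      case True
      with False ij q foldr_block[OF ij(1,2) w ps(1)] show ?thesis
        unfolding q(1) by (intro foldl_block_zero) auto
    next
      case False
      then have "foldr (\<otimes>) ps w = \<zero>"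
        unfolding p(1) using ij p w by (intro foldr_block_zero) auto
      then show ?thesis using qs words_closed by (simp add: foldl_zero)
    qed
    with x y show ?thesis by (simp add: f_zero)
  qed
qed (use assms block_closed in auto)

text \<open>Multiplication by \<open>B i j\<close>, where \<open>f\<close> is additive, separates the points of \<open>B i i\<close>.\<close>

lemma f_sum_diagonal:
  assumes i: "i \<in> I" and x: "x \<in> B i i" and y: "y \<in> B i i" and z: "z \<in> B i i"
    and sum: "f z = f x \<oplus>\<^bsub>S\<^esub> f y"
  shows "z = x \<oplus> y"
proof -
  obtain j where j: "j \<in> I" "j \<noteq> i" using other_index i by blast
  have c: "x \<in> carrier G" "y \<in> carrier G" "z \<in> carrier G"
    using x y z i block_closed by auto
  \<comment> \<open>The factor b followed by m - 2 letters makes the m - 1 factors that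
    \<open>f_sum_foldl\<close> requires, hence separation by words of length m - 2 at this
    point.\<close>
  have eq: "z \<otimes> b = (x \<oplus> y) \<otimes> b" if b: "b \<in> B i j" for b
  proof (rule foldl_eqI[where k = "m - 2"])
    have bc: "b \<in> carrier G" using b i j block_closed by blast
    then show "z \<otimes> b \<in> carrier G" "(x \<oplus> y) \<otimes> b \<in> carrier G"
      using c mult_closed by auto
    fix qs assume qs: "length qs = m - 2" "set qs \<subseteq> diag"
    have qc: "set (b # qs) \<subseteq> carrier G" "length (b # qs) = m - 1"
      using bc qs words_closed m_ge_2 by auto
    have blk: "foldl (\<otimes>) w (b # qs) \<in> B i j" if "w \<in> B i i" for w
      using that b i j qs block_mult[of i i j w b] by (simp add: foldl_block)
    \<comment> \<open>After multiplication by b the products of x and y lie in \<open>B i j\<close>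
      with i distinct from j, where \<open>f\<close> is already additive.\<close>
    have "f (foldl (\<otimes>) z (b # qs)) = f (foldl (\<otimes>) x (b # qs) \<oplus> foldl (\<otimes>) y (b # qs))"
      using f_sum_foldl[OF c sum qc] f_add_off_diagonal[of i j] blk x y i j by simp
    then have "foldl (\<otimes>) z (b # qs) = foldl (\<otimes>) x (b # qs) \<oplus> foldl (\<otimes>) y (b # qs)"
      using c qc by (intro f_inj) (auto intro!: foldl_closed a_closed mult_closed)
    then show "foldl (\<otimes>) (z \<otimes> b) qs = foldl (\<otimes>) ((x \<oplus> y) \<otimes> b) qs"
      using c bc qc by (simp add: distrib_right foldl_add mult_closed)
  qed
  have "z \<oplus> \<ominus> (x \<oplus> y) = \<zero>"
  proof (rule faithful[of i j])
    show "z \<oplus> \<ominus> (x \<oplus> y) \<in> B i i"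
      using x y z i by (intro block_add block_minus) auto
    fix b assume b: "b \<in> B i j"
    then have bc: "b \<in> carrier G" using i j block_closed by blast
    show "(z \<oplus> \<ominus> (x \<oplus> y)) \<otimes> b = \<zero>"
      using eq[OF b] c bc by (simp add: distrib_right[of _ "\<ominus> (x \<oplus> y)"] l_minus r_neg mult_closed)
  qed (use i j in auto)
  with c show ?thesis using minus_eq_zero_imp_eq[of z "x \<oplus> y"] by simp
qed

text \<open>The preimage z is fixed before the reduction to words. For each pair of words, P z Q is
  then a preimage of \<open>f\<close> (P x Q) + \<open>f\<close> (P y Q) already known to lie in the
  same block as P x Q and P y Q.\<close>

theorem f_additive:
  assumes xy: "x \<in> carrier G" "y \<in> carrier G"
  shows "f (x \<oplus> y) = f x \<oplus>\<^bsub>S\<^esub> f y"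
proof -
  obtain z where z: "z \<in> carrier G" "f z = f x \<oplus>\<^bsub>S\<^esub> f y"
    using f_surj[OF S.a_closed[OF f_closed[OF xy(1)] f_closed[OF xy(2)]]] .
  show ?thesis
  proof (rule f_add_if_words[OF xy])
    fix ps qs
    assume ps: "set ps \<subseteq> diag" "length ps = m - 1" and qs: "set qs \<subseteq> diag" "length qs = m - 1"
    let ?w = "\<lambda>w. foldl (\<otimes>) (foldr (\<otimes>) ps w) qs"
    obtain i p ps' where p: "ps = p # ps'" "i \<in> I" "p \<in> B i i" "set ps' \<subseteq> diag"
      using ps by (rule word_Cons)
    \<comment> \<open>The letter is taken from the end of \<open>qs\<close>, since x, y and z lie in
      no particular block and only the outermost letters decide where the product lies.\<close>
    have "qs \<noteq> []" using qs(2) m_ge_2 by auto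
    then obtain qs' q where q': "qs = qs' @ [q]" by (metis rev_exhaust)
    with qs(1) obtain j where q: "j \<in> I" "q \<in> B j j" "set qs' \<subseteq> diag"
      by (auto simp: diag_def)
    have blk: "?w w \<in> B i j" if "w \<in> carrier G" for w
      unfolding p(1) q' using that p q by (intro word_block) auto
    have sum: "f (?w z) = f (?w x) \<oplus>\<^bsub>S\<^esub> f (?w y)"
      using f_sum_word[OF xy z ps qs] .
    show "f (?w x \<oplus> ?w y) = f (?w x) \<oplus>\<^bsub>S\<^esub> f (?w y)"
    proof (cases "i = j")
      case True
      \<comment> \<open>\<open>f_sum_diagonal\<close> asks for a preimage inside
        \<open>B i i\<close>; by \<open>blk\<close>, \<open>?w z\<close> is one.\<close>
      then have "?w z = ?w x \<oplus> ?w y"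
        using blk xy z p(2) sum by (intro f_sum_diagonal[of i]) auto
      with sum show ?thesis by simp
    next
      case False
      then show ?thesis using blk xy p(2) q(1) by (intro f_add_off_diagonal[of i j]) auto
    qed
  qed
qed

end


section \<open>Biadditivity of the products of entries\<close>

lemma tensor_relators_subset:
  assumes A: "bimodule R S A" and B: "bimodule S T B"
  shows "tensor_relators S A B \<subseteq> carrier (tensor_free A B)"
proof -
  interpret A: bimodule R S A by fact
  interpret B: bimodule S T B by fact
  have diff: "u - v \<in> carrier (tensor_free A B)"
    if "u \<in> carrier (tensor_free A B)" "v \<in> carrier (tensor_free A B)" for u v
    using that keys_diff[of u v] by (auto simp: tensor_free_def)
  have frag: "frag_of (a, b) \<in> carrier (tensor_free A B)" if "a \<in> carrier A" "b \<in> carrier B" for a b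
    using that by (simp add: tensor_free_def)
  show ?thesis
    unfolding tensor_relators_def
    by (auto intro!: diff frag A.rsmult_closed B.lsmult_closed)
qed

lemma tensor_kernel_subgroup:
  assumes "bimodule R S A" "bimodule S T B"
  shows "subgroup (tensor_kernel S A B) (tensor_free A B)"
  unfolding tensor_kernel_def
  using tensor_relators_subset[OF assms] group_free_Abelian_group
  by (intro group.generate_is_subgroup) (simp_all add: tensor_free_def)

lemma pure_tensor_closed:
  assumes "a \<in> carrier A" "b \<in> carrier B"
  shows "pure_tensor S A B a b \<in> carrier (tensor_product S A B)"
  using assms
  by (auto simp: pure_tensor_def tensor_product_def Let_def carrier_FactGroup tensor_free_def)

text \<open>One statement for additivity in either argument: both kinds of biadditivity relator have
  the shape \<open>frag_of\<close> minus \<open>frag_of\<close> minus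
  \<open>frag_of\<close>.\<close>

lemma pure_tensor_sum:
  assumes A: "bimodule R S A" and B: "bimodule S T B"
    and car: "a \<in> carrier A" "b \<in> carrier B" "a' \<in> carrier A" "b' \<in> carrier B"
      "a'' \<in> carrier A" "b'' \<in> carrier B"
    and rel: "frag_of (a, b) - frag_of (a', b') - frag_of (a'', b'') \<in> tensor_relators S A B"
  shows "pure_tensor S A B a b
    = pure_tensor S A B a' b' \<oplus>\<^bsub>tensor_product S A B\<^esub> pure_tensor S A B a'' b''"
proof -
  let ?F = "tensor_free A B" and ?K = "tensor_kernel S A B"
  let ?u = "frag_of (a, b)" and ?v = "frag_of (a', b')" and ?w = "frag_of (a'', b'')"
  interpret F: comm_group ?F
    unfolding tensor_free_def by (rule abelian_free_Abelian_group)
  have K: "subgroup ?K ?F" using tensor_kernel_subgroup[OF A B] .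
  interpret K: normal ?K ?F using K by (rule F.subgroup_imp_normal)
  have c: "?v \<in> carrier ?F" "?w \<in> carrier ?F"
    using car by (simp_all add: tensor_free_def)
  have "?u - ?v - ?w \<in> ?K"
    unfolding tensor_kernel_def using rel by (rule generate.incl)
  \<comment> \<open>The group operation of the free group is addition, so \<open>?u\<close> is a
    relator plus \<open>?v\<close> + \<open>?w\<close>. It thus lies in the coset of
    \<open>?v\<close> + \<open>?w\<close>, and the two cosets coincide.\<close>
  moreover have "?u = (?u - ?v - ?w) \<otimes>\<^bsub>?F\<^esub> (?v \<otimes>\<^bsub>?F\<^esub> ?w)"
    by (simp add: tensor_free_def)
  ultimately have "?u \<in> ?K #>\<^bsub>?F\<^esub> (?v \<otimes>\<^bsub>?F\<^esub> ?w)"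
    unfolding r_coset_def by blast
  then have "?K #>\<^bsub>?F\<^esub> (?v \<otimes>\<^bsub>?F\<^esub> ?w) = ?K #>\<^bsub>?F\<^esub> ?u"
    using c K by (intro F.repr_independence F.m_closed)
  with c show ?thesis
    by (simp add: pure_tensor_def tensor_product_def Let_def K.rcos_sum)
qed

context generalized_matrix_ring
begin

abbreviation I where "I \<equiv> {1..n}"

abbreviation c where "c \<equiv> circ R M \<phi>"

abbreviation G where "G \<equiv> matrix_ring n R M \<phi>"

lemma M_group: "\<lbrakk>i \<in> I; j \<in> I\<rbrakk> \<Longrightarrow> abelian_group (M i j)"
  using bimodule bimodule.axioms(3) by blast

lemma M_monoid: "\<lbrakk>i \<in> I; j \<in> I\<rbrakk> \<Longrightarrow> abelian_monoid (M i j)"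
  using M_group abelian_group.axioms(1) by blast

section \<open>Entry products obtained from tensors through \<open>\<phi>\<close>\<close>

lemma circ_closed:
  assumes "i \<in> I" "j \<in> I" "k \<in> I" "a \<in> carrier (M i j)" "b \<in> carrier (M j k)"
  shows "c i j k a b \<in> carrier (M i k)"
  using hom[OF assms(1-3)] pure_tensor_closed[OF assms(4,5)]
  unfolding bimodule_hom_def circ_def by blast

lemma circ_sum:
  assumes "i \<in> I" "j \<in> I" "k \<in> I" "a \<in> carrier (M i j)" "b \<in> carrier (M j k)"
    "a' \<in> carrier (M i j)" "b' \<in> carrier (M j k)" "a'' \<in> carrier (M i j)" "b'' \<in> carrier (M j k)"
    and "frag_of (a, b) - frag_of (a', b') - frag_of (a'', b'')
      \<in> tensor_relators (R j) (M i j) (M j k)"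
  shows "c i j k a b = c i j k a' b' \<oplus>\<^bsub>M i k\<^esub> c i j k a'' b''"
  unfolding circ_def pure_tensor_sum[OF bimodule[OF assms(1,2)] bimodule[OF assms(2,3)] assms(4-10)]
  using hom[OF assms(1-3)] pure_tensor_closed[OF assms(6,7)] pure_tensor_closed[OF assms(8,9)]
  unfolding bimodule_hom_def by blast

lemma circ_add_left:
  assumes "i \<in> I" "j \<in> I" "k \<in> I" "a \<in> carrier (M i j)" "a' \<in> carrier (M i j)" "b \<in> carrier (M j k)"
  shows "c i j k (a \<oplus>\<^bsub>M i j\<^esub> a') b = c i j k a b \<oplus>\<^bsub>M i k\<^esub> c i j k a' b"
proof -
  interpret abelian_group "M i j" using assms by (intro M_group)
  have "frag_of (a \<oplus>\<^bsub>M i j\<^esub> a', b) - frag_of (a, b) - frag_of (a', b)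
      \<in> tensor_relators (R j) (M i j) (M j k)"
    using assms unfolding tensor_relators_def by blast
  with assms show ?thesis by (intro circ_sum) auto
qed

lemma circ_add_right:
  assumes "i \<in> I" "j \<in> I" "k \<in> I" "a \<in> carrier (M i j)" "b \<in> carrier (M j k)" "b' \<in> carrier (M j k)"
  shows "c i j k a (b \<oplus>\<^bsub>M j k\<^esub> b') = c i j k a b \<oplus>\<^bsub>M i k\<^esub> c i j k a b'"
proof -
  interpret abelian_group "M j k" using assms by (intro M_group)
  have "frag_of (a, b \<oplus>\<^bsub>M j k\<^esub> b') - frag_of (a, b) - frag_of (a, b')
      \<in> tensor_relators (R j) (M i j) (M j k)"
    using assms unfolding tensor_relators_def by blast
  with assms show ?thesis by (intro circ_sum) auto
qed

end


section \<open>Additive maps and finite sums\<close>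

lemma additive_zero:
  assumes A: "abelian_group A" and B: "abelian_group B" and h: "h \<in> carrier A \<rightarrow> carrier B"
    and add: "\<And>x y. \<lbrakk>x \<in> carrier A; y \<in> carrier A\<rbrakk> \<Longrightarrow> h (x \<oplus>\<^bsub>A\<^esub> y) = h x \<oplus>\<^bsub>B\<^esub> h y"
  shows "h \<zero>\<^bsub>A\<^esub> = \<zero>\<^bsub>B\<^esub>"
proof -
  interpret A: abelian_group A by fact
  interpret B: abelian_group B by fact
  have hz: "h \<zero>\<^bsub>A\<^esub> \<in> carrier B" using h by auto
  have "h \<zero>\<^bsub>A\<^esub> \<oplus>\<^bsub>B\<^esub> h \<zero>\<^bsub>A\<^esub> = h \<zero>\<^bsub>A\<^esub>"
    using add[of "\<zero>\<^bsub>A\<^esub>" "\<zero>\<^bsub>A\<^esub>"] by simp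
  with hz show ?thesis by (metis B.add.l_cancel_one)
qed

lemma additive_finsum:
  assumes A: "abelian_group A" and B: "abelian_group B" and h: "h \<in> carrier A \<rightarrow> carrier B"
    and add: "\<And>x y. \<lbrakk>x \<in> carrier A; y \<in> carrier A\<rbrakk> \<Longrightarrow> h (x \<oplus>\<^bsub>A\<^esub> y) = h x \<oplus>\<^bsub>B\<^esub> h y"
    and "finite K" and "g \<in> K \<rightarrow> carrier A"
  shows "h (\<Oplus>\<^bsub>A\<^esub>k\<in>K. g k) = (\<Oplus>\<^bsub>B\<^esub>k\<in>K. h (g k))"
  using assms(5,6)
proof (induction K)
  case empty
  interpret A: abelian_group A by fact
  interpret B: abelian_group B by fact
  show ?case using additive_zero[OF A B h add] by simp
next
  case (insert k K)
  interpret A: abelian_group A by fact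
  interpret B: abelian_group B by fact
  have g: "g k \<in> carrier A" "g \<in> K \<rightarrow> carrier A" using insert.prems by auto
  then have hg: "(\<lambda>k. h (g k)) \<in> K \<rightarrow> carrier B" "h (g k) \<in> carrier B" using h by auto
  have "h (\<Oplus>\<^bsub>A\<^esub>k\<in>insert k K. g k) = h (g k \<oplus>\<^bsub>A\<^esub> (\<Oplus>\<^bsub>A\<^esub>k\<in>K. g k))"
    using insert.hyps g by (subst A.finsum_insert) auto
  also have "\<dots> = h (g k) \<oplus>\<^bsub>B\<^esub> (\<Oplus>\<^bsub>B\<^esub>k\<in>K. h (g k))"
    using insert.IH[OF g(2)] g add A.finsum_closed by simp
  also have "\<dots> = (\<Oplus>\<^bsub>B\<^esub>k\<in>insert k K. h (g k))"
    using insert.hyps hg by (subst B.finsum_insert) auto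
  finally show ?case .
qed

lemma (in abelian_monoid) finsum_swap:
  assumes "finite K" "finite L" "\<And>k l. \<lbrakk>k \<in> K; l \<in> L\<rbrakk> \<Longrightarrow> g k l \<in> carrier G"
  shows "(\<Oplus>k\<in>K. \<Oplus>l\<in>L. g k l) = (\<Oplus>l\<in>L. \<Oplus>k\<in>K. g k l)"
  using assms(1,3)
proof (induction K)
  case empty
  then show ?case by simp
next
  case (insert k K)
  have gk: "g k \<in> L \<rightarrow> carrier G" using insert.prems by auto
  have gK: "(\<lambda>l. \<Oplus>k\<in>K. g k l) \<in> L \<rightarrow> carrier G" "(\<lambda>k. \<Oplus>l\<in>L. g k l) \<in> K \<rightarrow> carrier G"
    using insert.prems by (auto intro!: finsum_closed)
  have "(\<Oplus>k\<in>insert k K. \<Oplus>l\<in>L. g k l) = (\<Oplus>l\<in>L. g k l) \<oplus> (\<Oplus>k\<in>K. \<Oplus>l\<in>L. g k l)"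
    using insert.hyps gk gK by (intro finsum_insert) (auto intro: finsum_closed)
  also have "\<dots> = (\<Oplus>l\<in>L. g k l) \<oplus> (\<Oplus>l\<in>L. \<Oplus>k\<in>K. g k l)"
    using insert.IH insert.prems by simp
  also have "\<dots> = (\<Oplus>l\<in>L. g k l \<oplus> (\<Oplus>k\<in>K. g k l))"
    using gk gK by (intro finsum_addf[symmetric])
  also have "\<dots> = (\<Oplus>l\<in>L. \<Oplus>k\<in>insert k K. g k l)"
  proof (rule finsum_cong')
    show "(\<lambda>l. \<Oplus>k\<in>insert k K. g k l) \<in> L \<rightarrow> carrier G"
      using insert.prems by (auto intro!: finsum_closed)
    show "g k l \<oplus> (\<Oplus>k\<in>K. g k l) = (\<Oplus>k\<in>insert k K. g k l)" if "l \<in> L" for l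
      using that insert.hyps insert.prems by (subst finsum_insert) auto
  qed simp
  finally show ?case .
qed


section \<open>Generalized matrix rings as Peirce rings\<close>

context generalized_matrix_ring
begin

section \<open>The ring axioms for matrices, checked entrywise\<close>

lemma carrier_G: "carrier G = (\<Pi>\<^sub>E (i, j)\<in>I \<times> I. carrier (M i j))"
  by (simp add: matrix_ring_def)

lemma entry_closed: "\<lbrakk>x \<in> carrier G; i \<in> I; j \<in> I\<rbrakk> \<Longrightarrow> x (i, j) \<in> carrier (M i j)"
  unfolding carrier_G by (drule PiE_mem[of _ _ _ "(i, j)"]) auto

lemma restrict_closed:
  assumes "\<And>i j. \<lbrakk>i \<in> I; j \<in> I\<rbrakk> \<Longrightarrow> g i j \<in> carrier (M i j)"
  shows "(\<lambda>(i, j)\<in>I \<times> I. g i j) \<in> carrier G"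
  unfolding carrier_G using assms by (intro restrict_PiE_iff[THEN iffD2]) auto

lemma matrix_eqI:
  assumes "x \<in> carrier G" "y \<in> carrier G"
    and "\<And>i j. \<lbrakk>i \<in> I; j \<in> I\<rbrakk> \<Longrightarrow> x (i, j) = y (i, j)"
  shows "x = y"
  using assms unfolding carrier_G by (intro PiE_ext) auto

lemma add_entry: "\<lbrakk>i \<in> I; j \<in> I\<rbrakk> \<Longrightarrow> (x \<oplus>\<^bsub>G\<^esub> y) (i, j) = x (i, j) \<oplus>\<^bsub>M i j\<^esub> y (i, j)"
  by (simp add: matrix_ring_def)

lemma zero_entry: "\<lbrakk>i \<in> I; j \<in> I\<rbrakk> \<Longrightarrow> \<zero>\<^bsub>G\<^esub> (i, j) = \<zero>\<^bsub>M i j\<^esub>"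
  by (simp add: matrix_ring_def)

lemma mult_entry:
  "\<lbrakk>i \<in> I; j \<in> I\<rbrakk>
    \<Longrightarrow> (x \<otimes>\<^bsub>G\<^esub> y) (i, j) = (\<Oplus>\<^bsub>M i j\<^esub>k\<in>I. c i k j (x (i, k)) (y (k, j)))"
  by (simp add: matrix_ring_def)

lemma add_closed:
  assumes "x \<in> carrier G" "y \<in> carrier G"
  shows "x \<oplus>\<^bsub>G\<^esub> y \<in> carrier G"
proof -
  have "(\<lambda>(i, j)\<in>I \<times> I. x (i, j) \<oplus>\<^bsub>M i j\<^esub> y (i, j)) \<in> carrier G"
    using assms by (intro restrict_closed abelian_groupE(1)[OF M_group] entry_closed)
  then show ?thesis by (simp add: matrix_ring_def)
qed

lemma zero_closed: "\<zero>\<^bsub>G\<^esub> \<in> carrier G"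
proof -
  have "(\<lambda>(i, j)\<in>I \<times> I. \<zero>\<^bsub>M i j\<^esub>) \<in> carrier G"
    by (intro restrict_closed abelian_groupE(2)[OF M_group])
  then show ?thesis by (simp add: matrix_ring_def)
qed

lemma terms_closed:
  assumes "x \<in> carrier G" "y \<in> carrier G" "i \<in> I" "j \<in> I"
  shows "(\<lambda>k. c i k j (x (i, k)) (y (k, j))) \<in> I \<rightarrow> carrier (M i j)"
  using assms entry_closed[OF assms(1)] entry_closed[OF assms(2)] by (auto intro!: circ_closed)

lemma mult_closed:
  assumes "x \<in> carrier G" "y \<in> carrier G"
  shows "x \<otimes>\<^bsub>G\<^esub> y \<in> carrier G"
proof -
  have "(\<lambda>(i, j)\<in>I \<times> I. \<Oplus>\<^bsub>M i j\<^esub>k\<in>I. c i k j (x (i, k)) (y (k, j))) \<in> carrier G"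
    using assms by (intro restrict_closed abelian_monoid.finsum_closed[OF M_monoid] terms_closed)
  then show ?thesis by (simp add: matrix_ring_def)
qed

lemma G_group: "abelian_group G"
proof (rule abelian_groupI)
  fix x y z assume x: "x \<in> carrier G"
  show "\<zero>\<^bsub>G\<^esub> \<oplus>\<^bsub>G\<^esub> x = x"
    using x by (intro matrix_eqI add_closed zero_closed)
      (simp_all add: add_entry zero_entry abelian_groupE(5)[OF M_group] entry_closed)
  show "\<exists>y\<in>carrier G. y \<oplus>\<^bsub>G\<^esub> x = \<zero>\<^bsub>G\<^esub>"
  proof
    let ?y = "\<lambda>(i, j)\<in>I \<times> I. \<ominus>\<^bsub>M i j\<^esub> x (i, j)"
    show y: "?y \<in> carrier G"
      using x by (intro restrict_closed abelian_group.a_inv_closed[OF M_group] entry_closed)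
    show "?y \<oplus>\<^bsub>G\<^esub> x = \<zero>\<^bsub>G\<^esub>"
      using x y by (intro matrix_eqI add_closed zero_closed)
        (simp_all add: add_entry zero_entry abelian_group.l_neg[OF M_group] entry_closed)
  qed
  assume y: "y \<in> carrier G"
  show "x \<oplus>\<^bsub>G\<^esub> y \<in> carrier G" using x y by (rule add_closed)
  show "x \<oplus>\<^bsub>G\<^esub> y = y \<oplus>\<^bsub>G\<^esub> x"
    using x y by (intro matrix_eqI add_closed)
      (simp_all add: add_entry abelian_groupE(4)[OF M_group] entry_closed)
  assume z: "z \<in> carrier G"
  show "x \<oplus>\<^bsub>G\<^esub> y \<oplus>\<^bsub>G\<^esub> z = x \<oplus>\<^bsub>G\<^esub> (y \<oplus>\<^bsub>G\<^esub> z)"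
    using x y z by (intro matrix_eqI add_closed)
      (simp_all add: add_entry abelian_groupE(3)[OF M_group] entry_closed)
qed (rule zero_closed)

lemma circ_left_map: "\<lbrakk>i \<in> I; j \<in> I; k \<in> I; b \<in> carrier (M j k)\<rbrakk>
    \<Longrightarrow> (\<lambda>a. c i j k a b) \<in> carrier (M i j) \<rightarrow> carrier (M i k)"
  by (auto intro: circ_closed)

lemma circ_right_map: "\<lbrakk>i \<in> I; j \<in> I; k \<in> I; a \<in> carrier (M i j)\<rbrakk>
    \<Longrightarrow> c i j k a \<in> carrier (M j k) \<rightarrow> carrier (M i k)"
  by (auto intro: circ_closed)

lemma circ_zero_left:
  assumes "i \<in> I" "j \<in> I" "k \<in> I" "b \<in> carrier (M j k)"
  shows "c i j k \<zero>\<^bsub>M i j\<^esub> b = \<zero>\<^bsub>M i k\<^esub>"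
  using additive_zero[OF M_group M_group circ_left_map circ_add_left] assms by blast

lemma circ_zero_right:
  assumes "i \<in> I" "j \<in> I" "k \<in> I" "a \<in> carrier (M i j)"
  shows "c i j k a \<zero>\<^bsub>M j k\<^esub> = \<zero>\<^bsub>M i k\<^esub>"
  using additive_zero[OF M_group M_group circ_right_map circ_add_right] assms by blast

lemma circ_finsum_left:
  assumes "i \<in> I" "j \<in> I" "k \<in> I" "b \<in> carrier (M j k)" "finite K" "g \<in> K \<rightarrow> carrier (M i j)"
  shows "c i j k (\<Oplus>\<^bsub>M i j\<^esub>l\<in>K. g l) b = (\<Oplus>\<^bsub>M i k\<^esub>l\<in>K. c i j k (g l) b)"
  using additive_finsum[OF M_group M_group circ_left_map circ_add_left] assms by blast

lemma circ_finsum_right: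
  assumes "i \<in> I" "j \<in> I" "k \<in> I" "a \<in> carrier (M i j)" "finite K" "g \<in> K \<rightarrow> carrier (M j k)"
  shows "c i j k a (\<Oplus>\<^bsub>M j k\<^esub>l\<in>K. g l) = (\<Oplus>\<^bsub>M i k\<^esub>l\<in>K. c i j k a (g l))"
  using additive_finsum[OF M_group M_group circ_right_map circ_add_right] assms by blast

text \<open>In entry (i, j) both sides expand to the double sum of x_ik (y_kl z_lj) over k and l.
  \<open>circ_assoc\<close> matches the terms and \<open>finsum_swap\<close> the order of
  summation.\<close>

lemma mult_assoc:
  assumes x: "x \<in> carrier G" and y: "y \<in> carrier G" and z: "z \<in> carrier G"
  shows "x \<otimes>\<^bsub>G\<^esub> y \<otimes>\<^bsub>G\<^esub> z = x \<otimes>\<^bsub>G\<^esub> (y \<otimes>\<^bsub>G\<^esub> z)"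
proof (rule matrix_eqI)
  fix i j assume ij: "i \<in> I" "j \<in> I"
  interpret abelian_group "M i j" using ij by (rule M_group)
  note ent = entry_closed[OF x] entry_closed[OF y] entry_closed[OF z]
  have tc: "c i k j (x (i, k)) (c k l j (y (k, l)) (z (l, j))) \<in> carrier (M i j)"
    if "k \<in> I" "l \<in> I" for k l
    using that ij ent by (intro circ_closed)
  have "(x \<otimes>\<^bsub>G\<^esub> y \<otimes>\<^bsub>G\<^esub> z) (i, j)
      = (\<Oplus>\<^bsub>M i j\<^esub>l\<in>I. \<Oplus>\<^bsub>M i j\<^esub>k\<in>I. c i k j (x (i, k)) (c k l j (y (k, l)) (z (l, j))))"
    unfolding mult_entry[OF ij]
  proof (rule finsum_cong')
    fix l assume l: "l \<in> I"
    have "c i l j ((x \<otimes>\<^bsub>G\<^esub> y) (i, l)) (z (l, j))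
        = (\<Oplus>\<^bsub>M i j\<^esub>k\<in>I. c i l j (c i k l (x (i, k)) (y (k, l))) (z (l, j)))"
      unfolding mult_entry[OF ij(1) l]
      using ij l ent terms_closed[OF x y] by (intro circ_finsum_left) auto
    also have "\<dots> = (\<Oplus>\<^bsub>M i j\<^esub>k\<in>I. c i k j (x (i, k)) (c k l j (y (k, l)) (z (l, j))))"
      using ij l ent tc by (intro finsum_cong' circ_assoc[symmetric]) auto
    finally show "c i l j ((x \<otimes>\<^bsub>G\<^esub> y) (i, l)) (z (l, j)) = \<dots>" .
  qed (use tc in \<open>auto intro!: finsum_closed\<close>)
  also have "\<dots> = (\<Oplus>\<^bsub>M i j\<^esub>k\<in>I. \<Oplus>\<^bsub>M i j\<^esub>l\<in>I. c i k j (x (i, k)) (c k l j (y (k, l)) (z (l, j))))"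
    using tc by (intro finsum_swap) auto
  also have "\<dots> = (x \<otimes>\<^bsub>G\<^esub> (y \<otimes>\<^bsub>G\<^esub> z)) (i, j)"
    unfolding mult_entry[OF ij]
  proof (rule finsum_cong')
    fix k assume k: "k \<in> I"
    show "(\<Oplus>\<^bsub>M i j\<^esub>l\<in>I. c i k j (x (i, k)) (c k l j (y (k, l)) (z (l, j))))
        = c i k j (x (i, k)) ((y \<otimes>\<^bsub>G\<^esub> z) (k, j))"
      unfolding mult_entry[OF k ij(2)]
      using ij k ent terms_closed[OF y z] by (intro circ_finsum_right[symmetric]) auto
  qed (use terms_closed[OF x mult_closed[OF y z] ij] in auto)
  finally show "(x \<otimes>\<^bsub>G\<^esub> y \<otimes>\<^bsub>G\<^esub> z) (i, j) = (x \<otimes>\<^bsub>G\<^esub> (y \<otimes>\<^bsub>G\<^esub> z)) (i, j)" .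
qed (use assms mult_closed in auto)

lemma G_ring: "nonunital_ring G"
proof (intro nonunital_ring.intro nonunital_ring_axioms.intro)
  fix x y z assume x: "x \<in> carrier G" and y: "y \<in> carrier G"
  show "x \<otimes>\<^bsub>G\<^esub> y \<in> carrier G" using x y by (rule mult_closed)
  assume z: "z \<in> carrier G"
  note ent = entry_closed[OF x] entry_closed[OF y] entry_closed[OF z]
  show "x \<otimes>\<^bsub>G\<^esub> y \<otimes>\<^bsub>G\<^esub> z = x \<otimes>\<^bsub>G\<^esub> (y \<otimes>\<^bsub>G\<^esub> z)"
    using x y z by (rule mult_assoc)
  show "(x \<oplus>\<^bsub>G\<^esub> y) \<otimes>\<^bsub>G\<^esub> z = x \<otimes>\<^bsub>G\<^esub> z \<oplus>\<^bsub>G\<^esub> y \<otimes>\<^bsub>G\<^esub> z"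
  proof (rule matrix_eqI)
    fix i j assume ij: "i \<in> I" "j \<in> I"
    interpret abelian_group "M i j" using ij by (rule M_group)
    have "((x \<oplus>\<^bsub>G\<^esub> y) \<otimes>\<^bsub>G\<^esub> z) (i, j)
        = (\<Oplus>\<^bsub>M i j\<^esub>k\<in>I. c i k j (x (i, k)) (z (k, j)) \<oplus>\<^bsub>M i j\<^esub> c i k j (y (i, k)) (z (k, j)))"
      unfolding mult_entry[OF ij] using ij ent
      by (intro finsum_cong') (auto simp: add_entry circ_add_left intro!: circ_closed a_closed)
    also have "\<dots> = (x \<otimes>\<^bsub>G\<^esub> z \<oplus>\<^bsub>G\<^esub> y \<otimes>\<^bsub>G\<^esub> z) (i, j)"
      unfolding add_entry[OF ij] mult_entry[OF ij]
      using ij x y z by (intro finsum_addf terms_closed)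
    finally show "((x \<oplus>\<^bsub>G\<^esub> y) \<otimes>\<^bsub>G\<^esub> z) (i, j) = (x \<otimes>\<^bsub>G\<^esub> z \<oplus>\<^bsub>G\<^esub> y \<otimes>\<^bsub>G\<^esub> z) (i, j)" .
  qed (use x y z in \<open>auto intro!: mult_closed add_closed\<close>)
  show "z \<otimes>\<^bsub>G\<^esub> (x \<oplus>\<^bsub>G\<^esub> y) = z \<otimes>\<^bsub>G\<^esub> x \<oplus>\<^bsub>G\<^esub> z \<otimes>\<^bsub>G\<^esub> y"
  proof (rule matrix_eqI)
    fix i j assume ij: "i \<in> I" "j \<in> I"
    interpret abelian_group "M i j" using ij by (rule M_group)
    have "(z \<otimes>\<^bsub>G\<^esub> (x \<oplus>\<^bsub>G\<^esub> y)) (i, j)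
        = (\<Oplus>\<^bsub>M i j\<^esub>k\<in>I. c i k j (z (i, k)) (x (k, j)) \<oplus>\<^bsub>M i j\<^esub> c i k j (z (i, k)) (y (k, j)))"
      unfolding mult_entry[OF ij] using ij ent
      by (intro finsum_cong') (auto simp: add_entry circ_add_right intro!: circ_closed a_closed)
    also have "\<dots> = (z \<otimes>\<^bsub>G\<^esub> x \<oplus>\<^bsub>G\<^esub> z \<otimes>\<^bsub>G\<^esub> y) (i, j)"
      unfolding add_entry[OF ij] mult_entry[OF ij]
      using ij x y z by (intro finsum_addf terms_closed)
    finally show "(z \<otimes>\<^bsub>G\<^esub> (x \<oplus>\<^bsub>G\<^esub> y)) (i, j) = (z \<otimes>\<^bsub>G\<^esub> x \<oplus>\<^bsub>G\<^esub> z \<otimes>\<^bsub>G\<^esub> y) (i, j)" .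
  qed (use x y z in \<open>auto intro!: mult_closed add_closed\<close>)
qed (rule G_group)

section \<open>Matrices supported at one position\<close>

definition single :: "nat \<Rightarrow> nat \<Rightarrow> 'a \<Rightarrow> nat \<times> nat \<Rightarrow> 'a" where
  "single i j a = (\<lambda>(k, l)\<in>I \<times> I. if k = i \<and> l = j then a else \<zero>\<^bsub>M k l\<^esub>)"

lemma single_entry:
  "\<lbrakk>k \<in> I; l \<in> I\<rbrakk> \<Longrightarrow> single i j a (k, l) = (if k = i \<and> l = j then a else \<zero>\<^bsub>M k l\<^esub>)"
  by (simp add: single_def)

lemma single_closed: "a \<in> carrier (M i j) \<Longrightarrow> single i j a \<in> carrier G"
  unfolding single_def by (rule restrict_closed) (auto intro: abelian_groupE(2)[OF M_group])

lemma single_zero: "single i j \<zero>\<^bsub>M i j\<^esub> = \<zero>\<^bsub>G\<^esub>"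
  by (auto simp: single_def matrix_ring_def restrict_def)

lemma single_eq_zero: "\<lbrakk>i \<in> I; j \<in> I; single i j a = \<zero>\<^bsub>G\<^esub>\<rbrakk> \<Longrightarrow> a = \<zero>\<^bsub>M i j\<^esub>"
  using single_entry[of i j i j a] zero_entry[of i j] by simp

text \<open>As for a multiple a e_ij of a matrix unit: row j of z, multiplied by a, moves to row i.
  In the companion \<open>mult_single_entry\<close> column i moves to column j.\<close>

lemma single_mult_entry:
  assumes i: "i \<in> I" and j: "j \<in> I" and a: "a \<in> carrier (M i j)" and z: "z \<in> carrier G"
    and kl: "k \<in> I" "l \<in> I"
  shows "(single i j a \<otimes>\<^bsub>G\<^esub> z) (k, l) = (if k = i then c i j l a (z (j, l)) else \<zero>\<^bsub>M k l\<^esub>)"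
proof -
  interpret abelian_group "M k l" using kl by (rule M_group)
  have ent: "z (p, l) \<in> carrier (M p l)" if "p \<in> I" for p
    using that z kl by (intro entry_closed)
  have zero: "\<zero>\<^bsub>M k l\<^esub> \<in> carrier (M k l)" by simp
  show ?thesis
  proof (cases "k = i")
    case True
    have "(single i j a \<otimes>\<^bsub>G\<^esub> z) (k, l)
        = (\<Oplus>\<^bsub>M k l\<^esub>p\<in>I. if p = j then c k p l a (z (p, l)) else \<zero>\<^bsub>M k l\<^esub>)"
      unfolding mult_entry[OF kl] using i j a kl ent zero True
      by (intro finsum_cong') (auto simp: single_entry circ_zero_left intro!: circ_closed)
    \<comment> \<open>The condition is turned round and the value made independent of p, which is
      the form that \<open>finsum_singleton\<close> collapses.\<close>
    also have "\<dots> = (\<Oplus>\<^bsub>M k l\<^esub>p\<in>I. if j = p then c k j l a (z (j, l)) else \<zero>\<^bsub>M k l\<^esub>)"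
      using i j a kl ent zero True by (intro finsum_cong') (auto intro!: circ_closed)
    also have "\<dots> = c k j l a (z (j, l))"
      using i j a kl ent True
      by (intro finsum_singleton[where f = "\<lambda>_. c k j l a (z (j, l))"]) (auto intro!: circ_closed)
    finally show ?thesis using True by simp
  next
    case False
    have "(single i j a \<otimes>\<^bsub>G\<^esub> z) (k, l) = (\<Oplus>\<^bsub>M k l\<^esub>p\<in>I. \<zero>\<^bsub>M k l\<^esub>)"
      unfolding mult_entry[OF kl] using kl ent False
      by (intro finsum_cong') (auto simp: single_entry circ_zero_left)
    with False show ?thesis by simp
  qed
qed

lemma mult_single_entry:
  assumes i: "i \<in> I" and j: "j \<in> I" and a: "a \<in> carrier (M i j)" and z: "z \<in> carrier G"
    and kl: "k \<in> I" "l \<in> I"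
  shows "(z \<otimes>\<^bsub>G\<^esub> single i j a) (k, l) = (if l = j then c k i j (z (k, i)) a else \<zero>\<^bsub>M k l\<^esub>)"
proof -
  interpret abelian_group "M k l" using kl by (rule M_group)
  have ent: "z (k, p) \<in> carrier (M k p)" if "p \<in> I" for p
    using that z kl by (intro entry_closed)
  have zero: "\<zero>\<^bsub>M k l\<^esub> \<in> carrier (M k l)" by simp
  show ?thesis
  proof (cases "l = j")
    case True
    have "(z \<otimes>\<^bsub>G\<^esub> single i j a) (k, l)
        = (\<Oplus>\<^bsub>M k l\<^esub>p\<in>I. if i = p then c k i l (z (k, i)) a else \<zero>\<^bsub>M k l\<^esub>)"
      unfolding mult_entry[OF kl] using i j a kl ent zero True
      by (intro finsum_cong') (auto simp: single_entry circ_zero_right intro!: circ_closed)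
    also have "\<dots> = c k i l (z (k, i)) a"
      using i j a kl ent True
      by (intro finsum_singleton[where f = "\<lambda>_. c k i l (z (k, i)) a"]) (auto intro!: circ_closed)
    finally show ?thesis using True by simp
  next
    case False
    have "(z \<otimes>\<^bsub>G\<^esub> single i j a) (k, l) = (\<Oplus>\<^bsub>M k l\<^esub>p\<in>I. \<zero>\<^bsub>M k l\<^esub>)"
      unfolding mult_entry[OF kl] using kl ent False
      by (intro finsum_cong') (auto simp: single_entry circ_zero_right)
    with False show ?thesis by simp
  qed
qed

lemma single_mult_single:
  assumes ij: "i \<in> I" "j \<in> I" "a \<in> carrier (M i j)" and k: "k \<in> I" "b \<in> carrier (M j k)"
  shows "single i j a \<otimes>\<^bsub>G\<^esub> single j k b = single i k (c i j k a b)"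
  using assms
  by (intro matrix_eqI mult_closed single_closed circ_closed)
    (auto simp: single_mult_entry single_entry single_closed circ_zero_right)

lemma single_mult_single_zero:
  assumes ij: "i \<in> I" "j \<in> I" "a \<in> carrier (M i j)"
    and kl: "k \<in> I" "l \<in> I" "b \<in> carrier (M k l)" and ne: "j \<noteq> k"
  shows "single i j a \<otimes>\<^bsub>G\<^esub> single k l b = \<zero>\<^bsub>G\<^esub>"
  using assms
  by (intro matrix_eqI mult_closed single_closed zero_closed)
    (auto simp: single_mult_entry single_entry single_closed circ_zero_right zero_entry)

lemma single_mult_single_corner:
  assumes i: "i \<in> I" "a \<in> carrier (M i i)" and j: "j \<in> I" "b \<in> carrier (M j j)"
    and z: "z \<in> carrier G"
  shows "single i i a \<otimes>\<^bsub>G\<^esub> z \<otimes>\<^bsub>G\<^esub> single j j b = single i j (c i j j (c i i j a (z (i, j))) b)"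
proof (rule matrix_eqI)
  note ea = single_closed[OF i(2)] and eb = single_closed[OF j(2)]
  note eaz = mult_closed[OF ea z]
  show "single i i a \<otimes>\<^bsub>G\<^esub> z \<otimes>\<^bsub>G\<^esub> single j j b \<in> carrier G"
    using eaz eb by (rule mult_closed)
  show "single i j (c i j j (c i i j a (z (i, j))) b) \<in> carrier G"
    using i j entry_closed[OF z i(1) j(1)] by (intro single_closed circ_closed)
  fix k l assume kl: "k \<in> I" "l \<in> I"
  show "(single i i a \<otimes>\<^bsub>G\<^esub> z \<otimes>\<^bsub>G\<^esub> single j j b) (k, l)
      = single i j (c i j j (c i i j a (z (i, j))) b) (k, l)"
    using i j kl
    by (simp add: mult_single_entry[OF j(1,1,2) eaz kl] single_mult_entry[OF i(1,1,2) z]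
        single_entry circ_zero_left)
qed

lemma single_add:
  assumes "i \<in> I" "j \<in> I" "a \<in> carrier (M i j)" "b \<in> carrier (M i j)"
  shows "single i j a \<oplus>\<^bsub>G\<^esub> single i j b = single i j (a \<oplus>\<^bsub>M i j\<^esub> b)"
  using assms
  by (intro matrix_eqI add_closed single_closed abelian_groupE(1)[OF M_group])
    (auto simp: add_entry single_entry abelian_groupE(2,5)[OF M_group])

section \<open>Blocks of matrices and the Peirce axioms\<close>

definition block :: "nat \<Rightarrow> nat \<Rightarrow> (nat \<times> nat \<Rightarrow> 'a) set" where
  "block i j = single i j ` carrier (M i j)"

lemma block_subgroup:
  assumes ij: "i \<in> I" "j \<in> I"
  shows "additive_subgroup (block i j) G"
proof (rule additive_subgroupI)
  interpret G: abelian_group G by (rule G_group)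
  interpret Mij: abelian_group "M i j" using ij by (rule M_group)
  show "subgroup (block i j) (add_monoid G)"
  proof (rule G.add.subgroupI)
    show "block i j \<subseteq> carrier G" unfolding block_def using single_closed by blast
    show "block i j \<noteq> {}" unfolding block_def using Mij.zero_closed by blast
    fix x assume "x \<in> block i j"
    then obtain a where a: "a \<in> carrier (M i j)" "x = single i j a" unfolding block_def by blast
    have "single i j (\<ominus>\<^bsub>M i j\<^esub> a) \<oplus>\<^bsub>G\<^esub> x = \<zero>\<^bsub>G\<^esub>"
      using a ij by (simp add: single_add Mij.l_neg single_zero)
    then have "\<ominus>\<^bsub>G\<^esub> x = single i j (\<ominus>\<^bsub>M i j\<^esub> a)"
      using a by (intro G.minus_equality) (auto intro: single_closed)
    with a show "\<ominus>\<^bsub>G\<^esub> x \<in> block i j" unfolding block_def by simp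
    fix y assume "y \<in> block i j"
    then obtain b where b: "b \<in> carrier (M i j)" "y = single i j b" unfolding block_def by blast
    show "x \<oplus>\<^bsub>G\<^esub> y \<in> block i j"
      unfolding a(2) b(2) single_add[OF ij a(1) b(1)] block_def using a b by blast
  qed
qed

lemma diagonal_simps:
  assumes "i \<in> I"
  shows "carrier (M i i) = carrier (R i)" "\<zero>\<^bsub>M i i\<^esub> = \<zero>\<^bsub>R i\<^esub>"
    "r \<triangleright>\<^bsub>M i i\<^esub> x = r \<otimes>\<^bsub>R i\<^esub> x" "x \<triangleleft>\<^bsub>M i i\<^esub> r = x \<otimes>\<^bsub>R i\<^esub> r"
  by (simp_all add: diagonal[OF assms] regular_bimodule_def)

text \<open>Off the diagonal this is \<open>two_sided_zero\<close>. On the diagonal, (r x) s = 0 for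
  all s gives r x = 0 by \<open>left_ann\<close>, and this for all r gives x = 0 by
  \<open>right_ann\<close>.\<close>

lemma entry_zero_if_corners_zero:
  assumes ij: "i \<in> I" "j \<in> I"
    and left_ann: "\<And>i a. \<lbrakk>i \<in> I; a \<in> carrier (R i); \<forall>r\<in>carrier (R i). a \<otimes>\<^bsub>R i\<^esub> r = \<zero>\<^bsub>R i\<^esub>\<rbrakk>
      \<Longrightarrow> a = \<zero>\<^bsub>R i\<^esub>"
    and right_ann: "\<And>i b. \<lbrakk>i \<in> I; b \<in> carrier (R i); \<forall>r\<in>carrier (R i). r \<otimes>\<^bsub>R i\<^esub> b = \<zero>\<^bsub>R i\<^esub>\<rbrakk>
      \<Longrightarrow> b = \<zero>\<^bsub>R i\<^esub>"
    and x: "x \<in> carrier (M i j)"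
    and zero: "\<And>r s. \<lbrakk>r \<in> carrier (R i); s \<in> carrier (R j)\<rbrakk>
      \<Longrightarrow> (r \<triangleright>\<^bsub>M i j\<^esub> x) \<triangleleft>\<^bsub>M i j\<^esub> s = \<zero>\<^bsub>M i j\<^esub>"
  shows "x = \<zero>\<^bsub>M i j\<^esub>"
proof (cases "i = j")
  case False
  with ij x zero show ?thesis by (intro two_sided_zero) auto
next
  case True
  interpret Ri: nonunital_ring "R i" using ij by (intro ring)
  have xR: "x \<in> carrier (R i)" using x True ij diagonal_simps by simp
  have "x = \<zero>\<^bsub>R i\<^esub>"
  proof (rule right_ann)
    show "\<forall>r\<in>carrier (R i). r \<otimes>\<^bsub>R i\<^esub> x = \<zero>\<^bsub>R i\<^esub>"
    proof
      fix r assume r: "r \<in> carrier (R i)"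
      show "r \<otimes>\<^bsub>R i\<^esub> x = \<zero>\<^bsub>R i\<^esub>"
        using zero[OF r] True ij xR r
        by (intro left_ann Ri.mult_closed) (auto simp: diagonal_simps)
    qed
  qed (use ij xR in auto)
  with True ij show ?thesis by (simp add: diagonal_simps)
qed

lemma peirce_ring:
  assumes n: "n \<ge> 2"
    and left_ann: "\<And>i a. \<lbrakk>i \<in> I; a \<in> carrier (R i); \<forall>r\<in>carrier (R i). a \<otimes>\<^bsub>R i\<^esub> r = \<zero>\<^bsub>R i\<^esub>\<rbrakk>
      \<Longrightarrow> a = \<zero>\<^bsub>R i\<^esub>"
    and right_ann: "\<And>i b. \<lbrakk>i \<in> I; b \<in> carrier (R i); \<forall>r\<in>carrier (R i). r \<otimes>\<^bsub>R i\<^esub> b = \<zero>\<^bsub>R i\<^esub>\<rbrakk>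
      \<Longrightarrow> b = \<zero>\<^bsub>R i\<^esub>"
  shows "peirce_ring G I block"
proof (intro peirce_ring.intro peirce_ring_axioms.intro G_ring)
  fix i j assume ij: "i \<in> I" "j \<in> I"
  show "additive_subgroup (block i j) G" using ij by (rule block_subgroup)
next
  fix i j k a b assume "i \<in> I" "j \<in> I" "k \<in> I" "a \<in> block i j" "b \<in> block j k"
  then show "a \<otimes>\<^bsub>G\<^esub> b \<in> block i k"
    by (auto simp: block_def single_mult_single intro!: imageI circ_closed)
next
  fix i j k l a b
  assume "i \<in> I" "j \<in> I" "k \<in> I" "l \<in> I" "j \<noteq> k" "a \<in> block i j" "b \<in> block k l"
  then show "a \<otimes>\<^bsub>G\<^esub> b = \<zero>\<^bsub>G\<^esub>"
    by (auto simp: block_def single_mult_single_zero)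
next
  fix i j a z b
  assume "i \<in> I" "j \<in> I" "a \<in> block i i" "z \<in> carrier G" "b \<in> block j j"
  moreover from this have "z (i, j) \<in> carrier (M i j)" by (intro entry_closed)
  ultimately show "a \<otimes>\<^bsub>G\<^esub> z \<otimes>\<^bsub>G\<^esub> b \<in> block i j"
    by (auto simp: block_def single_mult_single_corner intro!: imageI circ_closed)
next
  fix z assume z: "z \<in> carrier G"
    and corners: "\<And>i j a b. \<lbrakk>i \<in> I; j \<in> I; a \<in> block i i; b \<in> block j j\<rbrakk>
      \<Longrightarrow> a \<otimes>\<^bsub>G\<^esub> z \<otimes>\<^bsub>G\<^esub> b = \<zero>\<^bsub>G\<^esub>"
  show "z = \<zero>\<^bsub>G\<^esub>"
  proof (rule matrix_eqI[OF z zero_closed])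
    fix i j assume ij: "i \<in> I" "j \<in> I"
    have zij: "z (i, j) \<in> carrier (M i j)" using z ij by (rule entry_closed)
    have "z (i, j) = \<zero>\<^bsub>M i j\<^esub>"
    proof (rule entry_zero_if_corners_zero[OF ij left_ann right_ann zij])
      fix r s assume r: "r \<in> carrier (R i)" and s: "s \<in> carrier (R j)"
      have rM: "r \<in> carrier (M i i)" and sM: "s \<in> carrier (M j j)"
        using r s ij by (simp_all add: diagonal_simps)
      have rz: "r \<triangleright>\<^bsub>M i j\<^esub> z (i, j) \<in> carrier (M i j)"
        using bimodule.lsmult_closed[OF bimodule[OF ij] r zij] .
      have "single i i r \<otimes>\<^bsub>G\<^esub> z \<otimes>\<^bsub>G\<^esub> single j j s = \<zero>\<^bsub>G\<^esub>"
        using ij rM sM by (intro corners[of i j]) (auto simp: block_def)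
      \<comment> \<open>The corner is supported at position (i, j), so its vanishing is that of the
        single entry (r z_ij) s.\<close>
      then have "c i j j (c i i j r (z (i, j))) s = \<zero>\<^bsub>M i j\<^esub>"
        using ij rM sM z by (intro single_eq_zero) (auto simp: single_mult_single_corner)
      then show "(r \<triangleright>\<^bsub>M i j\<^esub> z (i, j)) \<triangleleft>\<^bsub>M i j\<^esub> s = \<zero>\<^bsub>M i j\<^esub>"
        using left_canonical[OF ij r zij] right_canonical[OF ij rz s] by simp
    qed
    with ij show "z (i, j) = \<zero>\<^bsub>G\<^esub> (i, j)" by (simp add: zero_entry)
  qed
next
  fix i j u assume ij: "i \<in> I" "j \<in> I" "i \<noteq> j" and u: "u \<in> block i i"
    and ann: "\<And>b. b \<in> block i j \<Longrightarrow> u \<otimes>\<^bsub>G\<^esub> b = \<zero>\<^bsub>G\<^esub>"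
  obtain r where r: "r \<in> carrier (M i i)" "u = single i i r"
    using u unfolding block_def by blast
  have rR: "r \<in> carrier (R i)" using r ij by (simp add: diagonal_simps)
  \<comment> \<open>Testing \<open>u\<close> against the matrices supported at (i, j) recovers the
    action of r on all of \<open>M i j\<close>, to which \<open>left_faithful\<close>
    applies.\<close>
  have "r \<triangleright>\<^bsub>M i j\<^esub> x = \<zero>\<^bsub>M i j\<^esub>" if x: "x \<in> carrier (M i j)" for x
  proof -
    have "single i i r \<otimes>\<^bsub>G\<^esub> single i j x = \<zero>\<^bsub>G\<^esub>"
      unfolding r(2)[symmetric] using x by (intro ann) (simp add: block_def)
    then have "c i i j r x = \<zero>\<^bsub>M i j\<^esub>"
      using ij r x by (intro single_eq_zero) (auto simp: single_mult_single)
    then show ?thesis using left_canonical[OF ij(1,2) rR x] by simp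
  qed
  then have "r = \<zero>\<^bsub>R i\<^esub>" using left_faithful[OF ij rR] by blast
  then show "u = \<zero>\<^bsub>G\<^esub>"
    using r(2) single_zero[of i i] ij by (simp add: diagonal_simps)
next
  fix i assume "i \<in> I"
  show "\<exists>j\<in>I. j \<noteq> i"
    using n by (intro bexI[of _ "if i = 1 then 2 else 1"]) auto
qed

end

section \<open>Additivity on generalized matrix rings\<close>

theorem theorem3p1:
  fixes n m :: nat
    and R :: "nat \<Rightarrow> 'a ring"
    and M :: "nat \<Rightarrow> nat \<Rightarrow> ('a, 'a, 'a) bimodule"
    and \<phi> :: "nat \<Rightarrow> nat \<Rightarrow> nat \<Rightarrow> ('a \<times> 'a \<Rightarrow>\<^sub>0 int) set \<Rightarrow> 'a"
    and S :: "('b, 'c) ring_scheme"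
    and f :: "(nat \<times> nat \<Rightarrow> 'a) \<Rightarrow> 'b"
  defines "G \<equiv> matrix_ring n R M \<phi>"
  assumes "n \<ge> 2" and "m \<ge> 2"
    and "generalized_matrix_ring n R M \<phi>"
    and "\<And>i j a. \<lbrakk>i \<in> {1..n}; j \<in> {1..n}; i \<noteq> j; a \<in> carrier (R i);
           \<forall>r\<in>carrier (R i). a \<otimes>\<^bsub>R i\<^esub> r = \<zero>\<^bsub>R i\<^esub>\<rbrakk> \<Longrightarrow> a = \<zero>\<^bsub>R i\<^esub>"
    and "\<And>i j b. \<lbrakk>i \<in> {1..n}; j \<in> {1..n}; i \<noteq> j; b \<in> carrier (R j);
           \<forall>r\<in>carrier (R j). r \<otimes>\<^bsub>R j\<^esub> b = \<zero>\<^bsub>R j\<^esub>\<rbrakk> \<Longrightarrow> b = \<zero>\<^bsub>R j\<^esub>"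
    and "nonunital_ring S"
    and "multiplicative_iso m G S f"
  shows "\<forall>x\<in>carrier G. \<forall>y\<in>carrier G. f (x \<oplus>\<^bsub>G\<^esub> y) = f x \<oplus>\<^bsub>S\<^esub> f y"
proof -
  interpret generalized_matrix_ring n R M \<phi> by fact
  \<comment> \<open>The annihilator conditions are stated for pairs of distinct indices. Since n is
    at least 2, every index has a partner, so both conditions hold for each diagonal ring.\<close>
  have other: "\<exists>j. j \<in> {1..n} \<and> j \<noteq> i" for i
    using \<open>n \<ge> 2\<close> by (intro exI[of _ "if i = 1 then 2 else 1"]) auto
  interpret peirce_ring G "{1..n}" block
    unfolding G_def
  proof (rule peirce_ring)
    fix i a assume i: "i \<in> {1..n}" "a \<in> carrier (R i)"
    obtain j where j: "j \<in> {1..n}" "j \<noteq> i" using other by blast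
    show "a = \<zero>\<^bsub>R i\<^esub>" if "\<forall>r\<in>carrier (R i). a \<otimes>\<^bsub>R i\<^esub> r = \<zero>\<^bsub>R i\<^esub>"
      using assms(5)[OF i(1) j(1) j(2)[symmetric] i(2) that] .
    show "a = \<zero>\<^bsub>R i\<^esub>" if "\<forall>r\<in>carrier (R i). r \<otimes>\<^bsub>R i\<^esub> a = \<zero>\<^bsub>R i\<^esub>"
      using assms(6)[OF j(1) i(1) j(2) i(2) that] .
  qed fact
  interpret S: nonunital_ring S by fact
  interpret peirce_multiplicative_iso G "{1..n}" block S m f
    by unfold_locales fact+
  show ?thesis using f_additive by blast
qed

end
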